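(* Let $H$ be a weak Hopf algebra over a field $k$. (1) If $g\in H$ is a group-like element, then the map $h\mapsto ghg^{-1}$, $h\in H$, is a weak Hopf algebra automorphism of $H$. (2) If $H$ is finite dimensional and $\gamma\in H^*$ is a group-like element (of the dual weak Hopf algebra), then the map $h\mapsto(\gamma\rightharpoonup h\leftharpoonup\gamma^{-1})$, $h\in H$, is a weak Hopf algebra automorphism of $H$.
   Context: A weak Hopf algebra over a field $k$ is a $k$-vector space $H$ with an associative unital algebra structure $(m,1)$, a coassociative counital coalgebra structure $(\Delta,\epsilon)$ (Sweedler notation $\Delta(h)=h_{(1)}\otimes h_{(2)}$) and a linear map $S:H\to H$ (antipode) such that for all $f,g,h\in H$: $\Delta(hg)=\Delta(h)\Delta(g)$; $(\Delta\otimes\mathrm{id})\Delta(1)=(\Delta(1)\otimes1)(1\otimes\Delta(1))=(1\otimes\Delta(1))(\Delta(1)\otimes1)$; $\epsilon(fgh)=\epsilon(fg_{(1)})\epsilon(g_{(2)}h)=\epsilon(fg_{(2)})\epsilon(g_{(1)}h)$; $m(\mathrm{id}\otimes S)\Delta(h)=(\epsilon\otimes\mathrm{id})(\Delta(1)(h\otimes1))$; $m(S\otimes\mathrm{id})\Delta(h)=(\mathrm{id}\otimes\epsilon)((1\otimes h)\Delta(1))$; $S(h)=S(h_{(1)})h_{(2)}S(h_{(3)})$. ($\Delta(1)\neq1\otimes1$ in general.) A morphism of weak Hopf algebras is an algebra and coalgebra homomorphism preserving $1$ and $\epsilon$ and commuting with antipodes; an automorphism is a bijective morphism $H\to H$.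 If $\dim_kH<\infty$, the dual space $H^*$ is a weak Hopf algebra via $\langle\phi\psi,h\rangle=\langle\phi\otimes\psi,\Delta(h)\rangle$, $\langle\Delta(\phi),h\otimes g\rangle=\langle\phi,hg\rangle$, $\langle S(\phi),h\rangle=\langle\phi,S(h)\rangle$, with unit $\epsilon$ and counit $\phi\mapsto\langle\phi,1\rangle$. Sweedler arrows: $\phi\rightharpoonup h=h_{(1)}\langle\phi,h_{(2)}\rangle$, $h\leftharpoonup\phi=\langle\phi,h_{(1)}\rangle h_{(2)}$. An element $g$ of a weak Hopf algebra is group-like if it is invertible and $\Delta(g)=(g\otimes g)\Delta(1)=\Delta(1)(g\otimes g)$. *)

theory Defs
  imports "Jordan_Normal_Form.Missing_VectorSpace" "HOL-Algebra.RingHom"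
begin

section \<open>Tensor products\<close>

text \<open>
  Elements of the tensor product of two modules \<open>M\<close>, \<open>N\<close> over \<open>K\<close> are formal sums
  \<open>a\<^sub>1 \<otimes> b\<^sub>1 + \<dots> + a\<^sub>n \<otimes> b\<^sub>n\<close>, written as lists of pairs, modulo the congruence generated by
  commutativity of addition and \<open>K\<close>-bilinearity of \<open>\<otimes>\<close>. No formal scalars are needed, since
  \<open>c (a \<otimes> b) = (c a) \<otimes> b\<close>; in particular the negative of \<open>a \<otimes> b\<close> is \<open>(-a) \<otimes> b\<close>. As there is no
  cancellation rule, the two rules for zero have to be listed.
\<close>

inductive_set tensor_rel ::
  "('k, 'r) ring_scheme \<Rightarrow> ('k, 'a, 'm) module_scheme \<Rightarrow> ('k, 'b, 'n) module_scheme
    \<Rightarrow> (('a \<times> 'b) list \<times> ('a \<times> 'b) list) set"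
  for K M N where
  refl: "xs \<in> lists (carrier M \<times> carrier N) \<Longrightarrow> (xs, xs) \<in> tensor_rel K M N"
| sym: "(xs, ys) \<in> tensor_rel K M N \<Longrightarrow> (ys, xs) \<in> tensor_rel K M N"
| trans: "(xs, ys) \<in> tensor_rel K M N \<Longrightarrow> (ys, zs) \<in> tensor_rel K M N
    \<Longrightarrow> (xs, zs) \<in> tensor_rel K M N"
| append: "(xs, xs') \<in> tensor_rel K M N \<Longrightarrow> (ys, ys') \<in> tensor_rel K M N
    \<Longrightarrow> (xs @ ys, xs' @ ys') \<in> tensor_rel K M N"
| comm: "xs \<in> lists (carrier M \<times> carrier N) \<Longrightarrow> ys \<in> lists (carrier M \<times> carrier N)
    \<Longrightarrow> (xs @ ys, ys @ xs) \<in> tensor_rel K M N"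
| add_left: "a \<in> carrier M \<Longrightarrow> a' \<in> carrier M \<Longrightarrow> b \<in> carrier N
    \<Longrightarrow> ([(a \<oplus>\<^bsub>M\<^esub> a', b)], [(a, b), (a', b)]) \<in> tensor_rel K M N"
| add_right: "a \<in> carrier M \<Longrightarrow> b \<in> carrier N \<Longrightarrow> b' \<in> carrier N
    \<Longrightarrow> ([(a, b \<oplus>\<^bsub>N\<^esub> b')], [(a, b), (a, b')]) \<in> tensor_rel K M N"
| zero_left: "b \<in> carrier N \<Longrightarrow> ([(\<zero>\<^bsub>M\<^esub>, b)], []) \<in> tensor_rel K M N"
| zero_right: "a \<in> carrier M \<Longrightarrow> ([(a, \<zero>\<^bsub>N\<^esub>)], []) \<in> tensor_rel K M N"
| scale: "c \<in> carrier K \<Longrightarrow> a \<in> carrier M \<Longrightarrow> b \<in> carrier N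
    \<Longrightarrow> ([(c \<odot>\<^bsub>M\<^esub> a, b)], [(a, c \<odot>\<^bsub>N\<^esub> b)]) \<in> tensor_rel K M N"

definition tensor_class ::
  "('k, 'r) ring_scheme \<Rightarrow> ('k, 'a, 'm) module_scheme \<Rightarrow> ('k, 'b, 'n) module_scheme
    \<Rightarrow> ('a \<times> 'b) list \<Rightarrow> ('a \<times> 'b) list set"
  where "tensor_class K M N xs = tensor_rel K M N `` {xs}"

definition pure_tensor ::
  "('k, 'r) ring_scheme \<Rightarrow> ('k, 'a, 'm) module_scheme \<Rightarrow> ('k, 'b, 'n) module_scheme
    \<Rightarrow> 'a \<Rightarrow> 'b \<Rightarrow> ('a \<times> 'b) list set"
  where "pure_tensor K M N a b = tensor_class K M N [(a, b)]"

text \<open>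
  The multiplication and unit are those of the tensor product of two algebras,
  \<open>(a \<otimes> b)(a' \<otimes> b') = aa' \<otimes> bb'\<close>; they are meaningful only if \<open>M\<close> and \<open>N\<close> are algebras.
\<close>

definition tensor ::
  "('k, 'r) ring_scheme \<Rightarrow> ('k, 'a, 'm) module_scheme \<Rightarrow> ('k, 'b, 'n) module_scheme
    \<Rightarrow> ('k, ('a \<times> 'b) list set) module"
  where "tensor K M N =
    \<lparr> carrier = lists (carrier M \<times> carrier N) // tensor_rel K M N,
      mult = (\<lambda>T U. \<Union>xs\<in>T. \<Union>ys\<in>U. tensor_class K M N
        (map (\<lambda>((a, b), (a', b')). (a \<otimes>\<^bsub>M\<^esub> a', b \<otimes>\<^bsub>N\<^esub> b')) (List.product xs ys))),
      one = pure_tensor K M N \<one>\<^bsub>M\<^esub> \<one>\<^bsub>N\<^esub>,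
      zero = tensor_class K M N [],
      add = (\<lambda>T U. \<Union>xs\<in>T. \<Union>ys\<in>U. tensor_class K M N (xs @ ys)),
      smult = (\<lambda>c T. \<Union>xs\<in>T. tensor_class K M N (map (\<lambda>(a, b). (c \<odot>\<^bsub>M\<^esub> a, b)) xs)) \<rparr>"

text \<open>
  The additive map \<open>a \<otimes> b \<mapsto> \<beta> a b\<close> into \<open>P\<close> induced by a bilinear map \<open>\<beta>\<close>; for bilinear \<open>\<beta>\<close> the
  image below is a singleton.
\<close>

definition tensor_lift ::
  "('p, 'q) ring_scheme \<Rightarrow> ('a \<Rightarrow> 'b \<Rightarrow> 'p) \<Rightarrow> ('a \<times> 'b) list set \<Rightarrow> 'p"
  where "tensor_lift P \<beta> T =
    the_elem ((\<lambda>xs. foldr (\<lambda>(a, b) p. \<beta> a b \<oplus>\<^bsub>P\<^esub> p) xs \<zero>\<^bsub>P\<^esub>) ` T)"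

text \<open>The map \<open>f \<otimes> g\<close> into the tensor product of \<open>P\<close> and \<open>Q\<close>, for linear \<open>f\<close> and \<open>g\<close>.\<close>

definition tensor_map ::
  "('k, 'r) ring_scheme \<Rightarrow> ('k, 'c, 'm) module_scheme \<Rightarrow> ('k, 'd, 'n) module_scheme
    \<Rightarrow> ('a \<Rightarrow> 'c) \<Rightarrow> ('b \<Rightarrow> 'd) \<Rightarrow> ('a \<times> 'b) list set \<Rightarrow> ('c \<times> 'd) list set"
  where "tensor_map K P Q f g =
    tensor_lift (tensor K P Q) (\<lambda>a b. pure_tensor K P Q (f a) (g b))"

text \<open>The canonical isomorphism \<open>(L \<otimes> M) \<otimes> N \<rightarrow> L \<otimes> (M \<otimes> N)\<close>.\<close>

definition tensor_assoc ::
  "('k, 'r) ring_scheme \<Rightarrow> ('k, 'a, 'l) module_scheme \<Rightarrow> ('k, 'b, 'm) module_scheme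
    \<Rightarrow> ('k, 'c, 'n) module_scheme
    \<Rightarrow> (('a \<times> 'b) list set \<times> 'c) list set \<Rightarrow> ('a \<times> ('b \<times> 'c) list set) list set"
  where "tensor_assoc K L M N =
    (let P = tensor K L (tensor K M N) in
      tensor_lift P (\<lambda>t c.
        tensor_lift P (\<lambda>a b. pure_tensor K L (tensor K M N) a (pure_tensor K M N b c)) t))"


section \<open>Weak Hopf algebras\<close>

record ('k, 'h) weak_hopf = "('k, 'h) module" +
  comult :: "'h \<Rightarrow> ('h \<times> 'h) list set"
  counit :: "'h \<Rightarrow> 'k"
  antipode :: "'h \<Rightarrow> 'h"

definition self_module :: "('k, 'r) ring_scheme \<Rightarrow> ('k, 'k) module"
  where "self_module K =
    \<lparr> carrier = carrier K, mult = mult K, one = one K, zero = zero K, add = add K,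
      smult = mult K \<rparr>"

locale unital_assoc_algebra = VS?: vectorspace K A + Alg?: ring A
  for K :: "('k, 'r) ring_scheme" and A :: "('k, 'a, 'm) module_scheme" +
  assumes smult_mult_left:
      "c \<in> carrier K \<Longrightarrow> x \<in> carrier A \<Longrightarrow> y \<in> carrier A
        \<Longrightarrow> (c \<odot>\<^bsub>A\<^esub> x) \<otimes>\<^bsub>A\<^esub> y = c \<odot>\<^bsub>A\<^esub> (x \<otimes>\<^bsub>A\<^esub> y)"
    and smult_mult_right:
      "c \<in> carrier K \<Longrightarrow> x \<in> carrier A \<Longrightarrow> y \<in> carrier A
        \<Longrightarrow> x \<otimes>\<^bsub>A\<^esub> (c \<odot>\<^bsub>A\<^esub> y) = c \<odot>\<^bsub>A\<^esub> (x \<otimes>\<^bsub>A\<^esub> y)"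

text \<open>
  \<open>H \<otimes> H \<otimes> H\<close> is modelled as \<open>H \<otimes> (H \<otimes> H)\<close>; the associator transports elements of
  \<open>(H \<otimes> H) \<otimes> H\<close> to it. A subterm \<open>tensor_lift P \<beta> (comult H h)\<close> is the Sweedler sum
  \<open>\<beta> h\<^sub>(\<^sub>1\<^sub>) h\<^sub>(\<^sub>2\<^sub>)\<close> in \<open>P\<close>.
\<close>

locale weak_hopf_algebra = unital_assoc_algebra K H
  for K :: "('k, 'r) ring_scheme" and H :: "('k, 'h, 'm) weak_hopf_scheme" +
  assumes comult_linear: "comult H \<in> module_hom K H (tensor K H H)"
    and counit_linear: "counit H \<in> module_hom K H (self_module K)"
    and antipode_linear: "antipode H \<in> module_hom K H H"
    and coassoc:
      "h \<in> carrier H \<Longrightarrow>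
        tensor_assoc K H H H
          (tensor_map K (tensor K H H) H (comult H) (\<lambda>x. x) (comult H h))
        = tensor_map K H (tensor K H H) (\<lambda>x. x) (comult H) (comult H h)"
    and counit_left:
      "h \<in> carrier H \<Longrightarrow> tensor_lift H (\<lambda>a b. counit H a \<odot>\<^bsub>H\<^esub> b) (comult H h) = h"
    and counit_right:
      "h \<in> carrier H \<Longrightarrow> tensor_lift H (\<lambda>a b. counit H b \<odot>\<^bsub>H\<^esub> a) (comult H h) = h"
    and comult_mult:
      "h \<in> carrier H \<Longrightarrow> g \<in> carrier H
        \<Longrightarrow> comult H (h \<otimes>\<^bsub>H\<^esub> g) = comult H h \<otimes>\<^bsub>tensor K H H\<^esub> comult H g"
    and comult_one_left:
      "tensor_assoc K H H H
          (tensor_map K (tensor K H H) H (comult H) (\<lambda>x. x) (comult H \<one>\<^bsub>H\<^esub>))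
        = tensor_assoc K H H H (pure_tensor K (tensor K H H) H (comult H \<one>\<^bsub>H\<^esub>) \<one>\<^bsub>H\<^esub>)
          \<otimes>\<^bsub>tensor K H (tensor K H H)\<^esub>
          pure_tensor K H (tensor K H H) \<one>\<^bsub>H\<^esub> (comult H \<one>\<^bsub>H\<^esub>)"
    and comult_one_right:
      "tensor_assoc K H H H
          (tensor_map K (tensor K H H) H (comult H) (\<lambda>x. x) (comult H \<one>\<^bsub>H\<^esub>))
        = pure_tensor K H (tensor K H H) \<one>\<^bsub>H\<^esub> (comult H \<one>\<^bsub>H\<^esub>)
          \<otimes>\<^bsub>tensor K H (tensor K H H)\<^esub>
          tensor_assoc K H H H (pure_tensor K (tensor K H H) H (comult H \<one>\<^bsub>H\<^esub>) \<one>\<^bsub>H\<^esub>)"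
    and counit_mult:
      "f \<in> carrier H \<Longrightarrow> g \<in> carrier H \<Longrightarrow> h \<in> carrier H \<Longrightarrow>
        counit H (f \<otimes>\<^bsub>H\<^esub> g \<otimes>\<^bsub>H\<^esub> h)
        = tensor_lift K (\<lambda>a b. counit H (f \<otimes>\<^bsub>H\<^esub> a) \<otimes>\<^bsub>K\<^esub> counit H (b \<otimes>\<^bsub>H\<^esub> h)) (comult H g)"
    and counit_mult_flip:
      "f \<in> carrier H \<Longrightarrow> g \<in> carrier H \<Longrightarrow> h \<in> carrier H \<Longrightarrow>
        counit H (f \<otimes>\<^bsub>H\<^esub> g \<otimes>\<^bsub>H\<^esub> h)
        = tensor_lift K (\<lambda>a b. counit H (f \<otimes>\<^bsub>H\<^esub> b) \<otimes>\<^bsub>K\<^esub> counit H (a \<otimes>\<^bsub>H\<^esub> h)) (comult H g)"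
    and antipode_right:
      "h \<in> carrier H \<Longrightarrow>
        tensor_lift H (\<lambda>a b. a \<otimes>\<^bsub>H\<^esub> antipode H b) (comult H h)
        = tensor_lift H (\<lambda>a b. counit H a \<odot>\<^bsub>H\<^esub> b)
            (comult H \<one>\<^bsub>H\<^esub> \<otimes>\<^bsub>tensor K H H\<^esub> pure_tensor K H H h \<one>\<^bsub>H\<^esub>)"
    and antipode_left:
      "h \<in> carrier H \<Longrightarrow>
        tensor_lift H (\<lambda>a b. antipode H a \<otimes>\<^bsub>H\<^esub> b) (comult H h)
        = tensor_lift H (\<lambda>a b. counit H b \<odot>\<^bsub>H\<^esub> a)
            (pure_tensor K H H \<one>\<^bsub>H\<^esub> h \<otimes>\<^bsub>tensor K H H\<^esub> comult H \<one>\<^bsub>H\<^esub>)"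
    and antipode_convolution:
      "h \<in> carrier H \<Longrightarrow>
        antipode H h
        = tensor_lift H
            (\<lambda>t c. tensor_lift H (\<lambda>a b. antipode H a \<otimes>\<^bsub>H\<^esub> b) t \<otimes>\<^bsub>H\<^esub> antipode H c)
            (tensor_map K (tensor K H H) H (comult H) (\<lambda>x. x) (comult H h))"

definition weak_hopf_hom ::
  "('k, 'r) ring_scheme \<Rightarrow> ('k, 'h, 'm) weak_hopf_scheme \<Rightarrow> ('k, 'g, 'n) weak_hopf_scheme
    \<Rightarrow> ('h \<Rightarrow> 'g) set"
  where "weak_hopf_hom K H G =
    {f \<in> module_hom K H G \<inter> ring_hom H G.
      (\<forall>h\<in>carrier H. comult G (f h) = tensor_map K G G f f (comult H h)
        \<and> counit G (f h) = counit H h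
        \<and> antipode G (f h) = f (antipode H h))}"

definition weak_hopf_auto ::
  "('k, 'r) ring_scheme \<Rightarrow> ('k, 'h, 'm) weak_hopf_scheme \<Rightarrow> ('h \<Rightarrow> 'h) set"
  where "weak_hopf_auto K H =
    {f \<in> weak_hopf_hom K H H. bij_betw f (carrier H) (carrier H)}"

definition group_like ::
  "('k, 'r) ring_scheme \<Rightarrow> ('k, 'h, 'm) weak_hopf_scheme \<Rightarrow> 'h \<Rightarrow> bool"
  where "group_like K H g \<longleftrightarrow> g \<in> Units H
    \<and> comult H g = pure_tensor K H H g g \<otimes>\<^bsub>tensor K H H\<^esub> comult H \<one>\<^bsub>H\<^esub>
    \<and> comult H g = comult H \<one>\<^bsub>H\<^esub> \<otimes>\<^bsub>tensor K H H\<^esub> pure_tensor K H H g g"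


section \<open>The dual of a finite-dimensional weak Hopf algebra\<close>

text \<open>
  A linear functional is represented by a function that is \<open>undefined\<close> outside \<open>carrier H\<close>, so
  that equal functionals are equal as HOL functions.
\<close>

definition dual_algebra ::
  "('k, 'r) ring_scheme \<Rightarrow> ('k, 'h, 'm) weak_hopf_scheme \<Rightarrow> ('k, 'h \<Rightarrow> 'k) module"
  where "dual_algebra K H =
    \<lparr> carrier = module_hom K H (self_module K) \<inter> extensional (carrier H),
      mult = (\<lambda>\<phi> \<psi>. \<lambda>h\<in>carrier H. tensor_lift K (\<lambda>a b. \<phi> a \<otimes>\<^bsub>K\<^esub> \<psi> b) (comult H h)),
      one = (\<lambda>h\<in>carrier H. counit H h),
      zero = (\<lambda>h\<in>carrier H. \<zero>\<^bsub>K\<^esub>),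
      add = (\<lambda>\<phi> \<psi>. \<lambda>h\<in>carrier H. \<phi> h \<oplus>\<^bsub>K\<^esub> \<psi> h),
      smult = (\<lambda>c \<phi>. \<lambda>h\<in>carrier H. c \<otimes>\<^bsub>K\<^esub> \<phi> h) \<rparr>"

text \<open>
  The comultiplication of \<open>\<phi>\<close> is the element of \<open>H\<^sup>* \<otimes> H\<^sup>*\<close> determined by
  \<open>\<langle>\<Delta>(\<phi>), h \<otimes> g\<rangle> = \<langle>\<phi>, hg\<rangle>\<close>; it exists and is unique if \<open>H\<close> is finite-dimensional.
\<close>

definition dual ::
  "('k, 'r) ring_scheme \<Rightarrow> ('k, 'h, 'm) weak_hopf_scheme \<Rightarrow> ('k, 'h \<Rightarrow> 'k) weak_hopf"
  where "dual K H = module.extend (dual_algebra K H)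
    (weak_hopf.fields
      (\<lambda>\<phi>. THE T. T \<in> carrier (tensor K (dual_algebra K H) (dual_algebra K H))
        \<and> (\<forall>h\<in>carrier H. \<forall>g\<in>carrier H.
              tensor_lift K (\<lambda>\<alpha> \<beta>. \<alpha> h \<otimes>\<^bsub>K\<^esub> \<beta> g) T = \<phi> (h \<otimes>\<^bsub>H\<^esub> g)))
      (\<lambda>\<phi>. \<phi> \<one>\<^bsub>H\<^esub>)
      (\<lambda>\<phi>. \<lambda>h\<in>carrier H. \<phi> (antipode H h)))"

definition arrow_left :: "('k, 'h, 'm) weak_hopf_scheme \<Rightarrow> ('h \<Rightarrow> 'k) \<Rightarrow> 'h \<Rightarrow> 'h"
  where "arrow_left H \<phi> h = tensor_lift H (\<lambda>a b. \<phi> b \<odot>\<^bsub>H\<^esub> a) (comult H h)"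

definition arrow_right :: "('k, 'h, 'm) weak_hopf_scheme \<Rightarrow> 'h \<Rightarrow> ('h \<Rightarrow> 'k) \<Rightarrow> 'h"
  where "arrow_right H h \<phi> = tensor_lift H (\<lambda>a b. \<phi> a \<odot>\<^bsub>H\<^esub> b) (comult H h)"

end

theory Submission
  imports Defs
begin

text \<open>
  In both parts a bijection has to be shown to respect the whole structure. The unit, the counit and
  the antipode of a weak Hopf algebra are determined by its multiplication and comultiplication (the
  antipode by the usual argument with convolution inverses, where \<open>h\<^sub>(\<^sub>1\<^sub>) S(h\<^sub>(\<^sub>2\<^sub>))\<close> and \<open>S(h\<^sub>(\<^sub>1\<^sub>)) h\<^sub>(\<^sub>2\<^sub>)\<close>
  are given by the counit and \<open>\<Delta>(1)\<close>). So it suffices that the bijection is linear, multiplicative and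
  commutes with \<open>\<Delta>\<close>; this is \<open>weak_hopf_autoI\<close>.

  Conjugation by a group-like \<open>g\<close> is plainly a multiplicative bijection. It commutes with \<open>\<Delta>\<close>
  because \<open>\<Delta>(g) = (g \<otimes> g)\<Delta>(1)\<close> and \<open>\<Delta>(g\<^sup>-\<^sup>1) = \<Delta>(1)(g\<^sup>-\<^sup>1 \<otimes> g\<^sup>-\<^sup>1)\<close>, and \<open>\<Delta>(1)\<close> is absorbed by \<open>\<Delta>(h)\<close>.

  For the second part write \<open>L \<phi> h = h\<^sub>(\<^sub>1\<^sub>) \<phi>(h\<^sub>(\<^sub>2\<^sub>))\<close> and \<open>R \<phi> h = \<phi>(h\<^sub>(\<^sub>1\<^sub>)) h\<^sub>(\<^sub>2\<^sub>)\<close> for the arrows. They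
  satisfy \<open>L \<phi> (L \<psi> h) = L (\<phi>\<psi>) h\<close> and \<open>R \<psi> (R \<phi> h) = R (\<phi>\<psi>) h\<close> and commute with each other, so
  \<open>f = R \<gamma>\<^sup>-\<^sup>1 \<circ> L \<gamma>\<close> is bijective for invertible \<open>\<gamma>\<close>. The defining equations of a group-like functional,
  evaluated at \<open>h \<otimes> g\<close>, say \<open>\<gamma>(hg) = \<epsilon>(L \<gamma> h \<cdot> L \<gamma> g) = \<epsilon>(R \<gamma> h \<cdot> R \<gamma> g)\<close>, and this makes \<open>L \<gamma>\<close> and \<open>R \<gamma>\<close>
  multiplicative (\<open>L_mult\<close>, \<open>R_mult\<close>). Coassociativity gives
  \<open>\<Delta>(f(h)) = R \<gamma>\<^sup>-\<^sup>1 (h\<^sub>(\<^sub>1\<^sub>)) \<otimes> L \<gamma> (h\<^sub>(\<^sub>2\<^sub>)) = f(h\<^sub>(\<^sub>1\<^sub>)) \<otimes> f(h\<^sub>(\<^sub>2\<^sub>))\<close>, since the inner arrows in the last term cancel.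
  Finite dimension gives \<open>\<Delta>(\<gamma>)\<close> a meaning: an element of \<open>H\<^sup>* \<otimes> H\<^sup>*\<close> with the values \<open>\<gamma>(hg)\<close> exists and
  is unique (\<open>eval2_surj\<close>, \<open>eval2_inject\<close>), by expansion in a dual basis.

  Elements of a tensor product are classes of formal sums, and everything is computed through the
  universal property: \<open>tensor_lift P \<beta>\<close> is a linear map for bilinear \<open>\<beta>\<close>, and an identity between
  Sweedler sums is a chain of substitutions inside such maps (\<open>lift_tensor_map\<close>, \<open>lift_mult\<close>,
  \<open>coassoc_lift\<close>).
\<close>

section \<open>Linear and bilinear maps\<close>

(* Membership in lists stays folded, so that inductions over formal sums rewrite it by its rules
   for Nil, Cons and append instead of turning it into a statement about set. *)
declare in_listsI [rule del] in_listsD [rule del]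

lemma module_homI:
  assumes "\<And>x. x \<in> carrier M \<Longrightarrow> f x \<in> carrier N"
    and "\<And>x y. x \<in> carrier M \<Longrightarrow> y \<in> carrier M \<Longrightarrow> f (x \<oplus>\<^bsub>M\<^esub> y) = f x \<oplus>\<^bsub>N\<^esub> f y"
    and "\<And>c x. c \<in> carrier K \<Longrightarrow> x \<in> carrier M \<Longrightarrow> f (c \<odot>\<^bsub>M\<^esub> x) = c \<odot>\<^bsub>N\<^esub> f x"
  shows "f \<in> module_hom K M N"
  using assms by (auto simp: module_hom_def)

lemma module_hom_in: "f \<in> module_hom K M N \<Longrightarrow> x \<in> carrier M \<Longrightarrow> f x \<in> carrier N"
  by (auto simp: module_hom_def)

lemma module_hom_zero:
  assumes "module K M" "module K N" "f \<in> module_hom K M N"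
  shows "f \<zero>\<^bsub>M\<^esub> = \<zero>\<^bsub>N\<^esub>"
  by (intro mod_hom.f0_is_0[of K M N f] mod_hom.intro mod_hom_axioms.intro assms)

lemma module_hom_cong:
  assumes "\<And>x. x \<in> carrier M \<Longrightarrow> f x = g x" "module K M" "g \<in> module_hom K M N"
  shows "f \<in> module_hom K M N"
proof -
  interpret M: module K M by fact
  show ?thesis
    using assms(1,3) by (auto simp: module_hom_def)
qed

lemma module_hom_ident: "(\<lambda>x. x) \<in> module_hom K M M"
  by (auto simp: module_hom_def)

lemma module_hom_compose:
  "g \<in> module_hom K N P \<Longrightarrow> f \<in> module_hom K M N \<Longrightarrow> (\<lambda>x. g (f x)) \<in> module_hom K M P"
  by (auto simp: module_hom_def Pi_def)

lemma module_hom_const_zero: "module K P \<Longrightarrow> (\<lambda>x. \<zero>\<^bsub>P\<^esub>) \<in> module_hom K M P"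
proof -
  assume "module K P"
  then interpret P: module K P .
  show ?thesis by (intro module_homI) auto
qed

lemma module_hom_plus:
  assumes "module K P" "f \<in> module_hom K M P" "g \<in> module_hom K M P"
  shows "(\<lambda>x. f x \<oplus>\<^bsub>P\<^esub> g x) \<in> module_hom K M P"
proof -
  interpret P: module K P by fact
  note [simp] = module_hom_in[OF assms(2)] module_hom_in[OF assms(3)]
    module_hom_add[OF assms(2)] module_hom_add[OF assms(3)]
    module_hom_smult[OF assms(2)] module_hom_smult[OF assms(3)]
  show ?thesis
    by (intro module_homI) (auto simp: P.a_ac P.smult_r_distr)
qed

lemma module_hom_scale:
  assumes "module K P" "c \<in> carrier K" "f \<in> module_hom K M P"
  shows "(\<lambda>x. c \<odot>\<^bsub>P\<^esub> f x) \<in> module_hom K M P"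
proof -
  interpret P: module K P by fact
  note [simp] = module_hom_in[OF assms(3)] module_hom_add[OF assms(3)] module_hom_smult[OF assms(3)]
  show ?thesis
    using assms(2)
    by (intro module_homI)
      (auto simp: P.smult_r_distr P.smult_assoc1[symmetric] P.R.m_comm)
qed

lemma self_module_simps [simp]:
  "carrier (self_module K) = carrier K" "zero (self_module K) = zero K"
  "add (self_module K) = add K" "smult (self_module K) = mult K"
  by (simp_all add: self_module_def)

lemma module_hom_scale_vector:
  assumes "module K P" "v \<in> carrier P" "f \<in> module_hom K M (self_module K)"
  shows "(\<lambda>x. f x \<odot>\<^bsub>P\<^esub> v) \<in> module_hom K M P"
proof -
  interpret P: module K P by fact
  have [simp]: "f x \<in> carrier K" if "x \<in> carrier M" for x
    using module_hom_in[OF assms(3) that] by simp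
  note [simp] = module_hom_add[OF assms(3)] module_hom_smult[OF assms(3)]
  show ?thesis
    using assms(2) by (intro module_homI) (auto simp: P.smult_l_distr P.smult_assoc1)
qed

lemma self_module_module: "cring K \<Longrightarrow> module K (self_module K)"
proof -
  assume "cring K"
  then interpret cring K .
  have "abelian_group (self_module K)"
    by (intro abelian_groupI) (auto simp: a_ac intro: l_neg)
  then show ?thesis
    by (intro moduleI) (auto simp: l_distr r_distr m_assoc is_cring)
qed

definition bilinear ::
  "('k, 'r) ring_scheme \<Rightarrow> ('k, 'a, 'm) module_scheme \<Rightarrow> ('k, 'b, 'n) module_scheme
    \<Rightarrow> ('k, 'p, 'q) module_scheme \<Rightarrow> ('a \<Rightarrow> 'b \<Rightarrow> 'p) \<Rightarrow> bool"
  where "bilinear K M N P \<beta> \<longleftrightarrow>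
    (\<forall>b\<in>carrier N. (\<lambda>a. \<beta> a b) \<in> module_hom K M P) \<and>
    (\<forall>a\<in>carrier M. \<beta> a \<in> module_hom K N P)"

lemma bilinearI:
  assumes "\<And>b. b \<in> carrier N \<Longrightarrow> (\<lambda>a. \<beta> a b) \<in> module_hom K M P"
    and "\<And>a. a \<in> carrier M \<Longrightarrow> (\<lambda>b. \<beta> a b) \<in> module_hom K N P"
  shows "bilinear K M N P \<beta>"
  using assms by (auto simp: bilinear_def)

lemma bilinear_left: "bilinear K M N P \<beta> \<Longrightarrow> b \<in> carrier N \<Longrightarrow> (\<lambda>a. \<beta> a b) \<in> module_hom K M P"
  by (auto simp: bilinear_def)

lemma bilinear_right: "bilinear K M N P \<beta> \<Longrightarrow> a \<in> carrier M \<Longrightarrow> \<beta> a \<in> module_hom K N P"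
  by (auto simp: bilinear_def)

lemma bilinear_in:
  "bilinear K M N P \<beta> \<Longrightarrow> a \<in> carrier M \<Longrightarrow> b \<in> carrier N \<Longrightarrow> \<beta> a b \<in> carrier P"
  by (auto simp: bilinear_def module_hom_def)

lemma bilinear_compose:
  assumes "bilinear K M N P \<beta>" "f \<in> module_hom K M' M" "g \<in> module_hom K N' N"
  shows "bilinear K M' N' P (\<lambda>a b. \<beta> (f a) (g b))"
  by (intro bilinearI module_hom_compose[OF bilinear_left[OF assms(1)] assms(2)]
      module_hom_compose[OF bilinear_right[OF assms(1)] assms(3)]
      module_hom_in[OF assms(2)] module_hom_in[OF assms(3)])

lemma bilinear_hom_compose:
  assumes "\<phi> \<in> module_hom K P Q" "bilinear K M N P \<beta>"
  shows "bilinear K M N Q (\<lambda>a b. \<phi> (\<beta> a b))"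
  by (intro bilinearI module_hom_compose[OF assms(1)] bilinear_left[OF assms(2)]
      bilinear_right[OF assms(2)])

lemma bilinear_flip: "bilinear K M N P \<beta> \<Longrightarrow> bilinear K N M P (\<lambda>b a. \<beta> a b)"
  by (auto simp: bilinear_def)

lemma bilinear_smult:
  "module K M \<Longrightarrow> bilinear K (self_module K) M M (\<lambda>c x. c \<odot>\<^bsub>M\<^esub> x)"
  by (intro bilinearI module_hom_scale_vector module_hom_scale module_hom_ident) simp_all

text \<open>
  The value of the map induced by \<open>\<beta>\<close> on a formal sum, before passing to classes. Expansions in a
  basis are written in the same way, with a list of pairs of basis vector and coordinate functional.
\<close>

definition pair_sum :: "('p, 'q) ring_scheme \<Rightarrow> ('a \<Rightarrow> 'b \<Rightarrow> 'p) \<Rightarrow> ('a \<times> 'b) list \<Rightarrow> 'p"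
  where "pair_sum P \<beta> xs = foldr (\<lambda>(a, b) p. \<beta> a b \<oplus>\<^bsub>P\<^esub> p) xs \<zero>\<^bsub>P\<^esub>"

lemma pair_sum_simps [simp]:
  "pair_sum P \<beta> [] = \<zero>\<^bsub>P\<^esub>"
  "pair_sum P \<beta> ((a, b) # xs) = \<beta> a b \<oplus>\<^bsub>P\<^esub> pair_sum P \<beta> xs"
  by (simp_all add: pair_sum_def)

lemma pair_sum_map:
  "pair_sum P \<beta> (map (\<lambda>(a, b). (f a b, g a b)) xs) = pair_sum P (\<lambda>a b. \<beta> (f a b) (g a b)) xs"
  by (induction xs) auto

lemma pair_sum_cong:
  assumes "xs \<in> lists (A \<times> B)" "\<And>a b. a \<in> A \<Longrightarrow> b \<in> B \<Longrightarrow> \<beta> a b = \<beta>' a b"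
  shows "pair_sum P \<beta> xs = pair_sum P \<beta>' xs"
  using assms by (induction xs) auto

lemma pair_sum_closed:
  assumes "abelian_group P" "xs \<in> lists (A \<times> B)" "\<And>a b. a \<in> A \<Longrightarrow> b \<in> B \<Longrightarrow> \<beta> a b \<in> carrier P"
  shows "pair_sum P \<beta> xs \<in> carrier P"
proof -
  interpret P: abelian_group P by fact
  show ?thesis using assms(2,3) by (induction xs) auto
qed

lemma pair_sum_append:
  assumes "abelian_group P" "xs \<in> lists (A \<times> B)" "ys \<in> lists (A \<times> B)"
    "\<And>a b. a \<in> A \<Longrightarrow> b \<in> B \<Longrightarrow> \<beta> a b \<in> carrier P"
  shows "pair_sum P \<beta> (xs @ ys) = pair_sum P \<beta> xs \<oplus>\<^bsub>P\<^esub> pair_sum P \<beta> ys"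
proof -
  interpret P: abelian_group P by fact
  have [simp]: "pair_sum P \<beta> zs \<in> carrier P" if "zs \<in> lists (A \<times> B)" for zs
    using pair_sum_closed[OF assms(1) that assms(4)] .
  show ?thesis using assms(2,3,4)
    by (induction xs) (auto simp: P.a_assoc)
qed

lemma module_hom_pair_sum:
  assumes "module K P" "module K Q" "\<phi> \<in> module_hom K P Q" "xs \<in> lists (A \<times> B)"
    "\<And>a b. a \<in> A \<Longrightarrow> b \<in> B \<Longrightarrow> \<beta> a b \<in> carrier P"
  shows "\<phi> (pair_sum P \<beta> xs) = pair_sum Q (\<lambda>a b. \<phi> (\<beta> a b)) xs"
proof -
  interpret P: module K P by fact
  have [simp]: "pair_sum P \<beta> zs \<in> carrier P" if "zs \<in> lists (A \<times> B)" for zs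
    using pair_sum_closed[OF P.abelian_group_axioms that assms(5)] .
  show ?thesis using assms(4,5)
    by (induction xs)
      (auto simp: module_hom_zero[OF assms(1-3)] module_hom_add[OF assms(3)])
qed

lemma pair_sum_in_module_hom:
  assumes "module K P" "xs \<in> lists (A \<times> B)"
    "\<And>a b. a \<in> A \<Longrightarrow> b \<in> B \<Longrightarrow> (\<lambda>x. \<beta> x a b) \<in> module_hom K M P"
  shows "(\<lambda>x. pair_sum P (\<beta> x) xs) \<in> module_hom K M P"
  using assms(2)
  by (induction xs) (auto intro!: module_hom_const_zero module_hom_plus assms)

lemma pair_sum_self_module [simp]: "pair_sum (self_module K) = pair_sum K"
  by (simp add: pair_sum_def[abs_def])

section \<open>The tensor product of two modules\<close>

locale two_modules = M: module K M + N: module K N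
  for K :: "('k, 'r) ring_scheme" and M :: "('k, 'a, 'm) module_scheme"
    and N :: "('k, 'b, 'n) module_scheme"
begin

abbreviation "MN \<equiv> tensor K M N"
abbreviation "formal_sums \<equiv> lists (carrier M \<times> carrier N)"

lemma tensor_rel_formal_sums:
  "(xs, ys) \<in> tensor_rel K M N \<Longrightarrow> xs \<in> formal_sums \<and> ys \<in> formal_sums"
  by (induction rule: tensor_rel.induct) auto

lemma equiv_tensor_rel: "equiv formal_sums (tensor_rel K M N)"
proof (rule equivI)
  show "tensor_rel K M N \<subseteq> formal_sums \<times> formal_sums"
    using tensor_rel_formal_sums by auto
  show "refl_on formal_sums (tensor_rel K M N)"
    by (auto intro!: refl_onI tensor_rel.refl)
  show "sym (tensor_rel K M N)" by (auto intro: symI tensor_rel.sym)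
  show "trans (tensor_rel K M N)" by (rule transI) (rule tensor_rel.trans)
qed

lemma class_closed: "xs \<in> formal_sums \<Longrightarrow> tensor_class K M N xs \<in> carrier MN"
  by (auto simp: tensor_def tensor_class_def intro: quotientI)

lemma pure_closed: "a \<in> carrier M \<Longrightarrow> b \<in> carrier N \<Longrightarrow> pure_tensor K M N a b \<in> carrier MN"
  unfolding pure_tensor_def by (rule class_closed) auto

lemma tensor_carrierE:
  assumes "T \<in> carrier MN"
  obtains xs where "xs \<in> formal_sums" "T = tensor_class K M N xs"
  using assms by (auto simp: tensor_def tensor_class_def elim: quotientE)

lemma class_eqI: "(xs, ys) \<in> tensor_rel K M N \<Longrightarrow> tensor_class K M N xs = tensor_class K M N ys"
  unfolding tensor_class_def using equiv_class_eq[OF equiv_tensor_rel] .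

lemma zero_tensor: "\<zero>\<^bsub>MN\<^esub> = tensor_class K M N []"
  by (simp add: tensor_def)

lemma add_class:
  assumes "xs \<in> formal_sums" "ys \<in> formal_sums"
  shows "tensor_class K M N xs \<oplus>\<^bsub>MN\<^esub> tensor_class K M N ys = tensor_class K M N (xs @ ys)"
proof -
  have "congruent2 (tensor_rel K M N) (tensor_rel K M N) (\<lambda>xs ys. tensor_class K M N (xs @ ys))"
    by (rule congruent2I', rule class_eqI, rule tensor_rel.append)
  from UN_equiv_class2[OF equiv_tensor_rel equiv_tensor_rel this assms] show ?thesis
    by (simp add: tensor_def tensor_class_def)
qed

lemma map_scale_formal_sums:
  "c \<in> carrier K \<Longrightarrow> xs \<in> formal_sums \<Longrightarrow> map (\<lambda>(a, b). (c \<odot>\<^bsub>M\<^esub> a, b)) xs \<in> formal_sums"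
  by (induction xs) auto

text \<open>
  Scalar multiplication of the left factors maps every generator of the congruence to a generator,
  so it descends to classes. Commutativity of \<open>K\<close> enters in the case of the balancing rule.
\<close>

lemma scale_rel:
  assumes "c \<in> carrier K" "(xs, ys) \<in> tensor_rel K M N"
  shows "(map (\<lambda>(a, b). (c \<odot>\<^bsub>M\<^esub> a, b)) xs, map (\<lambda>(a, b). (c \<odot>\<^bsub>M\<^esub> a, b)) ys) \<in> tensor_rel K M N"
  using assms(2)
proof (induction rule: tensor_rel.induct)
  case (refl xs)
  then show ?case using assms(1) by (intro tensor_rel.refl map_scale_formal_sums)
next
  case (sym xs ys)
  then show ?case by (blast intro: tensor_rel.sym)
next
  case (trans xs ys zs)
  then show ?case by (blast intro: tensor_rel.trans)
next
  case (append xs xs' ys ys')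
  then show ?case by (simp add: tensor_rel.append)
next
  case (comm xs ys)
  then show ?case unfolding map_append using assms(1) by (intro tensor_rel.comm map_scale_formal_sums)
next
  case (add_left a a' b)
  then show ?case using assms(1) by (simp add: M.smult_r_distr tensor_rel.add_left)
next
  case (add_right a b b')
  then show ?case using assms(1) by (simp add: tensor_rel.add_right)
next
  case (zero_left b)
  then show ?case using assms(1) by (simp add: tensor_rel.zero_left)
next
  case (zero_right a)
  then show ?case using assms(1) by (simp add: tensor_rel.zero_right)
next
  case (scale d a b)
  then have "c \<odot>\<^bsub>M\<^esub> (d \<odot>\<^bsub>M\<^esub> a) = d \<odot>\<^bsub>M\<^esub> (c \<odot>\<^bsub>M\<^esub> a)"
    using assms(1) by (simp add: M.smult_assoc1[symmetric] M.R.m_comm)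
  then show ?case using scale assms(1) by (simp add: tensor_rel.scale)
qed

lemma smult_class:
  assumes "c \<in> carrier K" "xs \<in> formal_sums"
  shows "c \<odot>\<^bsub>MN\<^esub> tensor_class K M N xs = tensor_class K M N (map (\<lambda>(a, b). (c \<odot>\<^bsub>M\<^esub> a, b)) xs)"
proof -
  have "congruent (tensor_rel K M N) (\<lambda>xs. tensor_class K M N (map (\<lambda>(a, b). (c \<odot>\<^bsub>M\<^esub> a, b)) xs))"
    by (rule congruentI, rule class_eqI, rule scale_rel[OF assms(1)])
  from UN_equiv_class[OF equiv_tensor_rel this assms(2)] show ?thesis
    by (simp add: tensor_def tensor_class_def)
qed

lemma class_Cons:
  "a \<in> carrier M \<Longrightarrow> b \<in> carrier N \<Longrightarrow> xs \<in> formal_sums \<Longrightarrow>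
    tensor_class K M N ((a, b) # xs) = pure_tensor K M N a b \<oplus>\<^bsub>MN\<^esub> tensor_class K M N xs"
  unfolding pure_tensor_def by (subst add_class) auto

lemma pure_add_left:
  assumes "a \<in> carrier M" "a' \<in> carrier M" "b \<in> carrier N"
  shows "pure_tensor K M N (a \<oplus>\<^bsub>M\<^esub> a') b = pure_tensor K M N a b \<oplus>\<^bsub>MN\<^esub> pure_tensor K M N a' b"
  using class_eqI[OF tensor_rel.add_left[where K = K, OF assms]] assms
  by (simp add: pure_tensor_def add_class)

lemma pure_add_right:
  assumes "a \<in> carrier M" "b \<in> carrier N" "b' \<in> carrier N"
  shows "pure_tensor K M N a (b \<oplus>\<^bsub>N\<^esub> b') = pure_tensor K M N a b \<oplus>\<^bsub>MN\<^esub> pure_tensor K M N a b'"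
  using class_eqI[OF tensor_rel.add_right[where K = K, OF assms]] assms
  by (simp add: pure_tensor_def add_class)

lemma pure_smult_left:
  assumes "c \<in> carrier K" "a \<in> carrier M" "b \<in> carrier N"
  shows "pure_tensor K M N (c \<odot>\<^bsub>M\<^esub> a) b = c \<odot>\<^bsub>MN\<^esub> pure_tensor K M N a b"
  using assms by (simp add: pure_tensor_def smult_class)

lemma pure_smult_right:
  assumes "c \<in> carrier K" "a \<in> carrier M" "b \<in> carrier N"
  shows "pure_tensor K M N a (c \<odot>\<^bsub>N\<^esub> b) = c \<odot>\<^bsub>MN\<^esub> pure_tensor K M N a b"
  using class_eqI[OF tensor_rel.scale[OF assms]] pure_smult_left[OF assms]
  by (simp add: pure_tensor_def)

lemma pure_zero_left: "b \<in> carrier N \<Longrightarrow> pure_tensor K M N \<zero>\<^bsub>M\<^esub> b = \<zero>\<^bsub>MN\<^esub>"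
  unfolding pure_tensor_def zero_tensor by (rule class_eqI) (rule tensor_rel.zero_left)

lemma abelian_monoid_tensor: "abelian_monoid MN"
proof (rule abelian_monoidI)
  fix S T U assume STU: "S \<in> carrier MN" "T \<in> carrier MN" "U \<in> carrier MN"
  obtain xs ys zs where *: "xs \<in> formal_sums" "S = tensor_class K M N xs"
    "ys \<in> formal_sums" "T = tensor_class K M N ys" "zs \<in> formal_sums" "U = tensor_class K M N zs"
    using STU by (elim tensor_carrierE) blast
  then show "S \<oplus>\<^bsub>MN\<^esub> T \<in> carrier MN" "\<zero>\<^bsub>MN\<^esub> \<oplus>\<^bsub>MN\<^esub> S = S"
    "S \<oplus>\<^bsub>MN\<^esub> T \<oplus>\<^bsub>MN\<^esub> U = S \<oplus>\<^bsub>MN\<^esub> (T \<oplus>\<^bsub>MN\<^esub> U)"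
    by (auto simp: add_class class_closed zero_tensor)
  show "S \<oplus>\<^bsub>MN\<^esub> T = T \<oplus>\<^bsub>MN\<^esub> S"
    using * by (simp add: add_class) (intro class_eqI tensor_rel.comm)
qed (simp add: zero_tensor class_closed)

lemma smult_tensor_closed: "c \<in> carrier K \<Longrightarrow> T \<in> carrier MN \<Longrightarrow> c \<odot>\<^bsub>MN\<^esub> T \<in> carrier MN"
  by (elim tensor_carrierE) (simp add: smult_class class_closed map_scale_formal_sums)

lemma smult_tensor_add:
  "c \<in> carrier K \<Longrightarrow> T \<in> carrier MN \<Longrightarrow> U \<in> carrier MN \<Longrightarrow>
    c \<odot>\<^bsub>MN\<^esub> (T \<oplus>\<^bsub>MN\<^esub> U) = c \<odot>\<^bsub>MN\<^esub> T \<oplus>\<^bsub>MN\<^esub> c \<odot>\<^bsub>MN\<^esub> U"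
  by (elim tensor_carrierE) (simp add: smult_class add_class map_scale_formal_sums)

lemma tensor_induct [consumes 1, case_names zero add]:
  assumes "T \<in> carrier MN" "Q \<zero>\<^bsub>MN\<^esub>"
    and "\<And>a b T. a \<in> carrier M \<Longrightarrow> b \<in> carrier N \<Longrightarrow> T \<in> carrier MN \<Longrightarrow> Q T \<Longrightarrow>
      Q (pure_tensor K M N a b \<oplus>\<^bsub>MN\<^esub> T)"
  shows "Q T"
proof -
  from assms(1) obtain xs where xs: "xs \<in> formal_sums" "T = tensor_class K M N xs"
    by (rule tensor_carrierE)
  have "Q (tensor_class K M N xs)" using xs(1)
  proof (induction xs)
    case Nil
    then show ?case using assms(2) by (simp add: zero_tensor)
  next
    case (Cons x xs)
    then show ?case using assms(3) by (cases x) (auto simp: class_Cons class_closed)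
  qed
  then show ?thesis using xs by simp
qed

lemma smult_zero_tensor: "c \<in> carrier K \<Longrightarrow> c \<odot>\<^bsub>MN\<^esub> \<zero>\<^bsub>MN\<^esub> = \<zero>\<^bsub>MN\<^esub>"
  by (simp add: zero_tensor smult_class)

text \<open>
  Scalars can be moved into the left factor of a pure tensor, so each module axiom is inherited from
  \<open>M\<close> by induction over sums of pure tensors. Negation is multiplication by \<open>-1\<close>: the formal sums
  themselves have no cancellation.
\<close>

lemma tensor_module: "module K MN"
proof -
  interpret T: abelian_monoid MN by (rule abelian_monoid_tensor)
  note [simp] = pure_closed smult_tensor_closed smult_tensor_add smult_zero_tensor
    pure_smult_left[symmetric]
  have l_distr: "(c \<oplus>\<^bsub>K\<^esub> d) \<odot>\<^bsub>MN\<^esub> T = c \<odot>\<^bsub>MN\<^esub> T \<oplus>\<^bsub>MN\<^esub> d \<odot>\<^bsub>MN\<^esub> T"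
    if "c \<in> carrier K" "d \<in> carrier K" "T \<in> carrier MN" for c d T
    using that(3,1,2)
    by (induction rule: tensor_induct) (auto simp: M.smult_l_distr pure_add_left T.a_ac)
  have one: "\<one>\<^bsub>K\<^esub> \<odot>\<^bsub>MN\<^esub> T = T" if "T \<in> carrier MN" for T
    using that by (induction rule: tensor_induct) auto
  have null: "\<zero>\<^bsub>K\<^esub> \<odot>\<^bsub>MN\<^esub> T = \<zero>\<^bsub>MN\<^esub>" if "T \<in> carrier MN" for T
    using that by (induction rule: tensor_induct) (auto simp: pure_zero_left)
  have "abelian_group MN"
  proof (rule abelian_groupI)
    fix T assume T: "T \<in> carrier MN"
    have "(\<ominus>\<^bsub>K\<^esub> \<one>\<^bsub>K\<^esub>) \<odot>\<^bsub>MN\<^esub> T \<oplus>\<^bsub>MN\<^esub> \<one>\<^bsub>K\<^esub> \<odot>\<^bsub>MN\<^esub> T = (\<ominus>\<^bsub>K\<^esub> \<one>\<^bsub>K\<^esub> \<oplus>\<^bsub>K\<^esub> \<one>\<^bsub>K\<^esub>) \<odot>\<^bsub>MN\<^esub> T"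
      using T by (simp add: l_distr)
    also have "\<dots> = \<zero>\<^bsub>MN\<^esub>" using T null by (simp add: M.R.l_neg)
    finally show "\<exists>U\<in>carrier MN. U \<oplus>\<^bsub>MN\<^esub> T = \<zero>\<^bsub>MN\<^esub>" using T one by auto
  qed (auto simp: T.a_ac)
  moreover have "(c \<otimes>\<^bsub>K\<^esub> d) \<odot>\<^bsub>MN\<^esub> T = c \<odot>\<^bsub>MN\<^esub> (d \<odot>\<^bsub>MN\<^esub> T)"
    if "c \<in> carrier K" "d \<in> carrier K" "T \<in> carrier MN" for c d T
    using that(3,1,2) by (induction rule: tensor_induct) (auto simp: M.smult_assoc1)
  ultimately show ?thesis
    by (intro moduleI) (auto simp: l_distr one M.R.is_cring)
qed

lemma bilinear_pure: "bilinear K M N MN (pure_tensor K M N)"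
  by (intro bilinearI module_homI)
    (auto simp: pure_closed pure_add_left pure_add_right pure_smult_left pure_smult_right)

text \<open>
  The universal property of the tensor product: each generator of the congruence is an instance of
  one of the identities that a bilinear map satisfies.
\<close>

lemma pair_sum_rel:
  assumes P: "module K P" and \<beta>: "bilinear K M N P \<beta>" and "(xs, ys) \<in> tensor_rel K M N"
  shows "pair_sum P \<beta> xs = pair_sum P \<beta> ys"
proof -
  interpret P: module K P by fact
  note [simp] = bilinear_in[OF \<beta>]
  note append = pair_sum_append[OF P.abelian_group_axioms, where \<beta> = \<beta>]
  note closed = pair_sum_closed[OF P.abelian_group_axioms, where \<beta> = \<beta>]
  from assms(3) show ?thesis
  proof (induction rule: tensor_rel.induct)
    case (append xs xs' ys ys')
    then show ?case
      using tensor_rel_formal_sums[OF append(1)] tensor_rel_formal_sums[OF append(2)]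
      by (simp add: pair_sum_append[OF P.abelian_group_axioms, of _ "carrier M" "carrier N"])
  next
    case (comm xs ys)
    then show ?case
      by (simp add: append[of _ "carrier M" "carrier N"] closed[of _ "carrier M" "carrier N"]
          P.a_comm)
  next
    case (add_left a a' b)
    then show ?case by (simp add: module_hom_add[OF bilinear_left[OF \<beta>]] P.a_assoc)
  next
    case (add_right a b b')
    then show ?case by (simp add: module_hom_add[OF bilinear_right[OF \<beta>]] P.a_assoc)
  next
    case (zero_left b)
    then show ?case
      by (simp add: module_hom_zero[OF M.module_axioms P bilinear_left[OF \<beta>]])
  next
    case (zero_right a)
    then show ?case
      by (simp add: module_hom_zero[OF N.module_axioms P bilinear_right[OF \<beta>]])
  next
    case (scale c a b)
    then show ?case
      by (simp add: module_hom_smult[OF bilinear_left[OF \<beta>]]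
          module_hom_smult[OF bilinear_right[OF \<beta>]])
  qed auto
qed

lemma lift_class:
  assumes "module K P" "bilinear K M N P \<beta>" "xs \<in> formal_sums"
  shows "tensor_lift P \<beta> (tensor_class K M N xs) = pair_sum P \<beta> xs"
proof -
  have "pair_sum P \<beta> ` tensor_class K M N xs = {pair_sum P \<beta> xs}"
    using pair_sum_rel[OF assms(1,2)] assms(3)
    by (auto simp: tensor_class_def image_iff intro: tensor_rel.refl)
  then show ?thesis by (simp add: tensor_lift_def pair_sum_def[abs_def])
qed

lemma tensor_class_subset: "T \<in> carrier MN \<Longrightarrow> xs \<in> T \<Longrightarrow> xs \<in> formal_sums"
  by (auto simp: tensor_def dest: tensor_rel_formal_sums elim!: quotientE)

lemma lift_cong:
  assumes "T \<in> carrier MN"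
    "\<And>a b. a \<in> carrier M \<Longrightarrow> b \<in> carrier N \<Longrightarrow> \<beta> a b = \<beta>' a b"
  shows "tensor_lift P \<beta> T = tensor_lift P \<beta>' T"
proof -
  have "pair_sum P \<beta> ` T = pair_sum P \<beta>' ` T"
    using assms by (intro image_cong refl pair_sum_cong[of _ "carrier M" "carrier N"])
      (auto intro: tensor_class_subset)
  then show ?thesis by (simp add: tensor_lift_def pair_sum_def[abs_def])
qed

lemma lift_pure:
  assumes "module K P" "bilinear K M N P \<beta>" "a \<in> carrier M" "b \<in> carrier N"
  shows "tensor_lift P \<beta> (pure_tensor K M N a b) = \<beta> a b"
proof -
  interpret P: module K P by fact
  show ?thesis using assms
    by (simp add: pure_tensor_def lift_class bilinear_in)
qed

lemma lift_hom:
  assumes P: "module K P" and \<beta>: "bilinear K M N P \<beta>"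
  shows "tensor_lift P \<beta> \<in> module_hom K MN P"
proof -
  interpret P: module K P by fact
  note closed = pair_sum_closed[OF P.abelian_group_axioms, of _ "carrier M" "carrier N"]
  show ?thesis
  proof (rule module_homI)
    fix T U assume "T \<in> carrier MN" "U \<in> carrier MN"
    then obtain xs ys where "xs \<in> formal_sums" "T = tensor_class K M N xs"
      "ys \<in> formal_sums" "U = tensor_class K M N ys"
      by (elim tensor_carrierE) blast
    then show "tensor_lift P \<beta> T \<in> carrier P"
      "tensor_lift P \<beta> (T \<oplus>\<^bsub>MN\<^esub> U) = tensor_lift P \<beta> T \<oplus>\<^bsub>P\<^esub> tensor_lift P \<beta> U"
      using \<beta>
      by (simp_all add: add_class lift_class[OF P \<beta>] closed bilinear_in
          pair_sum_append[OF P.abelian_group_axioms, of _ "carrier M" "carrier N"])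
  next
    fix c T assume c: "c \<in> carrier K" and "T \<in> carrier MN"
    then obtain xs where xs: "xs \<in> formal_sums" "T = tensor_class K M N xs"
      by (elim tensor_carrierE)
    have "pair_sum P (\<lambda>a b. \<beta> (c \<odot>\<^bsub>M\<^esub> a) b) xs = pair_sum P (\<lambda>a b. c \<odot>\<^bsub>P\<^esub> \<beta> a b) xs"
      using xs(1) c by (intro pair_sum_cong) (auto intro: module_hom_smult[OF bilinear_left[OF \<beta>]])
    also have "\<dots> = c \<odot>\<^bsub>P\<^esub> pair_sum P \<beta> xs"
      using module_hom_pair_sum[OF P P module_hom_scale[OF P c module_hom_ident] xs(1)]
        bilinear_in[OF \<beta>] by fastforce
    finally show "tensor_lift P \<beta> (c \<odot>\<^bsub>MN\<^esub> T) = c \<odot>\<^bsub>P\<^esub> tensor_lift P \<beta> T"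
      using xs c
      by (simp add: smult_class lift_class[OF P \<beta>] map_scale_formal_sums
          pair_sum_map[where f = "\<lambda>a b. c \<odot>\<^bsub>M\<^esub> a" and g = "\<lambda>a b. b"])
  qed
qed

lemma lift_closed:
  "module K P \<Longrightarrow> bilinear K M N P \<beta> \<Longrightarrow> T \<in> carrier MN \<Longrightarrow> tensor_lift P \<beta> T \<in> carrier P"
  by (rule module_hom_in[OF lift_hom])

lemma hom_lift:
  assumes "module K P" "module K Q" "\<phi> \<in> module_hom K P Q" "bilinear K M N P \<beta>" "T \<in> carrier MN"
  shows "\<phi> (tensor_lift P \<beta> T) = tensor_lift Q (\<lambda>a b. \<phi> (\<beta> a b)) T"
  using assms(5)
  by (elim tensor_carrierE)
    (simp add: lift_class[OF assms(1,4)] bilinear_in[OF assms(4)]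
      lift_class[OF assms(2) bilinear_hom_compose[OF assms(3,4)]]
      module_hom_pair_sum[OF assms(1-3), of _ "carrier M" "carrier N"])

lemma class_eq_pair_sum:
  "xs \<in> formal_sums \<Longrightarrow> tensor_class K M N xs = pair_sum MN (pure_tensor K M N) xs"
  by (induction xs) (auto simp: zero_tensor class_Cons)

lemma lift_pure_tensor: "T \<in> carrier MN \<Longrightarrow> tensor_lift MN (pure_tensor K M N) T = T"
  by (elim tensor_carrierE)
    (simp add: lift_class[OF tensor_module bilinear_pure], simp add: class_eq_pair_sum)

lemma tensor_hom_eqI:
  assumes "module K P" "F \<in> module_hom K MN P" "G \<in> module_hom K MN P" "T \<in> carrier MN"
    and "\<And>a b. a \<in> carrier M \<Longrightarrow> b \<in> carrier N \<Longrightarrow> F (pure_tensor K M N a b) = G (pure_tensor K M N a b)"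
  shows "F T = G T"
proof -
  have "F T = tensor_lift P (\<lambda>a b. F (pure_tensor K M N a b)) T"
    using hom_lift[OF tensor_module assms(1,2) bilinear_pure assms(4)] lift_pure_tensor[OF assms(4)]
    by simp
  also have "\<dots> = tensor_lift P (\<lambda>a b. G (pure_tensor K M N a b)) T"
    by (rule lift_cong[OF assms(4,5)])
  also have "\<dots> = G T"
    using hom_lift[OF tensor_module assms(1,3) bilinear_pure assms(4)] lift_pure_tensor[OF assms(4)]
    by simp
  finally show ?thesis .
qed

text \<open>
  When induced maps are nested, the inner one has to be linear in the variables of the outer one.
  On a fixed formal sum it is a finite sum of maps that are linear in the parameter.
\<close>

lemma lift_param_hom:
  assumes L: "module K L" and P: "module K P" and T: "T \<in> carrier MN"
    and "\<And>x. x \<in> carrier L \<Longrightarrow> bilinear K M N P (\<beta> x)"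
    and "\<And>a b. a \<in> carrier M \<Longrightarrow> b \<in> carrier N \<Longrightarrow> (\<lambda>x. \<beta> x a b) \<in> module_hom K L P"
  shows "(\<lambda>x. tensor_lift P (\<beta> x) T) \<in> module_hom K L P"
proof -
  obtain xs where xs: "xs \<in> formal_sums" "T = tensor_class K M N xs"
    using T by (rule tensor_carrierE)
  have "(\<lambda>x. pair_sum P (\<beta> x) xs) \<in> module_hom K L P"
    by (rule pair_sum_in_module_hom[OF P xs(1) assms(5)])
  then show ?thesis
    by (rule module_hom_cong[rotated 2]) (simp_all add: xs lift_class P assms(4) L)
qed

text \<open>
  The map \<open>f \<otimes> g\<close> is itself induced by a bilinear map, so this is a case of composing a linear map with
  an induced map. Read from left to right, it removes \<open>f \<otimes> g\<close> from a Sweedler sum.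
\<close>

lemma lift_tensor_map:
  assumes "two_modules K M' N'" "f \<in> module_hom K M M'" "g \<in> module_hom K N N'" "T \<in> carrier MN"
    and P: "module K P" and \<beta>: "bilinear K M' N' P \<beta>"
  shows "tensor_lift P \<beta> (tensor_map K M' N' f g T) = tensor_lift P (\<lambda>a b. \<beta> (f a) (g b)) T"
proof -
  interpret T': two_modules K M' N' by fact
  have fg: "bilinear K M N T'.MN (\<lambda>a b. pure_tensor K M' N' (f a) (g b))"
    by (rule bilinear_compose[OF T'.bilinear_pure assms(2,3)])
  have "tensor_lift P \<beta> (tensor_map K M' N' f g T)
    = tensor_lift P (\<lambda>a b. tensor_lift P \<beta> (pure_tensor K M' N' (f a) (g b))) T"
    unfolding tensor_map_def
    by (rule hom_lift[OF T'.tensor_module P T'.lift_hom[OF P \<beta>] fg assms(4)])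
  also have "\<dots> = tensor_lift P (\<lambda>a b. \<beta> (f a) (g b)) T"
    using module_hom_in[OF assms(2)] module_hom_in[OF assms(3)]
    by (intro lift_cong assms(4)) (simp add: T'.lift_pure[OF P \<beta>])
  finally show ?thesis .
qed

end

text \<open>
  The tensor product depends only on the module and ring operations of its factors, so the dual as a
  weak Hopf algebra and as an algebra have the same tensor square.
\<close>

lemma tensor_rel_subset:
  fixes K :: "('k, 'r) ring_scheme" and M :: "('k, 'a, 'm) module_scheme"
    and M' :: "('k, 'a, 'm2) module_scheme"
    and N :: "('k, 'b, 'n) module_scheme" and N' :: "('k, 'b, 'n2) module_scheme"
  assumes "carrier M = carrier M'" "add M = add M'" "zero M = zero M'" "smult M = smult M'"
    and "carrier N = carrier N'" "add N = add N'" "zero N = zero N'" "smult N = smult N'"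
  shows "tensor_rel K M N \<subseteq> tensor_rel K M' N'"
proof (rule subrelI)
  fix xs ys assume "(xs, ys) \<in> tensor_rel K M N"
  then show "(xs, ys) \<in> tensor_rel K M' N'"
  proof (induction rule: tensor_rel.induct)
    case (sym xs ys)
    then show ?case by (blast intro: tensor_rel.sym)
  next
    case (trans xs ys zs)
    then show ?case by (blast intro: tensor_rel.trans)
  qed (simp_all add: assms tensor_rel.intros(1,4-))
qed

lemma tensor_rel_cong:
  assumes "carrier M = carrier M'" "add M = add M'" "zero M = zero M'" "smult M = smult M'"
    and "carrier N = carrier N'" "add N = add N'" "zero N = zero N'" "smult N = smult N'"
  shows "tensor_rel K M N = tensor_rel K M' N'"
  by (rule equalityI; rule tensor_rel_subset) (simp_all add: assms)

lemma tensor_cong: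
  assumes "carrier M = carrier M'" "add M = add M'" "zero M = zero M'" "smult M = smult M'"
      "mult M = mult M'" "one M = one M'"
    and "carrier N = carrier N'" "add N = add N'" "zero N = zero N'" "smult N = smult N'"
      "mult N = mult N'" "one N = one N'"
  shows "tensor K M N = tensor K M' N'" "pure_tensor K M N = pure_tensor K M' N'"
  unfolding tensor_def pure_tensor_def[abs_def] tensor_class_def[abs_def]
    tensor_rel_cong[of M M' N N' K, OF assms(1-4) assms(7-10)] assms by simp_all

lemma tensor_lift_self_module [simp]: "tensor_lift (self_module K) = tensor_lift K"
  by (simp add: tensor_lift_def[abs_def])

section \<open>Multiplication on tensor products\<close>

text \<open>
  There are two instances: the algebra \<open>H\<close>, and the space of functionals on \<open>H\<close> with the convolution
  product.
\<close>

locale two_multiplicative_modules = two_modules K M N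
  for K :: "('k, 'r) ring_scheme" and M :: "('k, 'a, 'm) module_scheme"
    and N :: "('k, 'b, 'n) module_scheme" +
  assumes bilinear_mult_left: "bilinear K M M M (mult M)"
    and bilinear_mult_right: "bilinear K N N N (mult N)"
begin

abbreviation products :: "('a \<times> 'b) list \<Rightarrow> ('a \<times> 'b) list \<Rightarrow> ('a \<times> 'b) list"
  where "products xs ys \<equiv>
    map (\<lambda>((a, b), (a', b')). (a \<otimes>\<^bsub>M\<^esub> a', b \<otimes>\<^bsub>N\<^esub> b')) (List.product xs ys)"

lemma products_Cons:
  "products ((a, b) # xs) ys = map (\<lambda>(a', b'). (a \<otimes>\<^bsub>M\<^esub> a', b \<otimes>\<^bsub>N\<^esub> b')) ys @ products xs ys"
  by (simp add: case_prod_unfold)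

lemma map_mult_formal_sums:
  "a \<in> carrier M \<Longrightarrow> b \<in> carrier N \<Longrightarrow> ys \<in> formal_sums \<Longrightarrow>
    map (\<lambda>(a', b'). (a \<otimes>\<^bsub>M\<^esub> a', b \<otimes>\<^bsub>N\<^esub> b')) ys \<in> formal_sums"
  by (induction ys)
    (auto simp: bilinear_in[OF bilinear_mult_left] bilinear_in[OF bilinear_mult_right])

lemma products_formal_sums:
  "xs \<in> formal_sums \<Longrightarrow> ys \<in> formal_sums \<Longrightarrow> products xs ys \<in> formal_sums"
proof (induction xs)
  case (Cons x xs)
  then show ?case
    by (cases x) (simp only: products_Cons append_in_lists_conv, simp add: map_mult_formal_sums)
qed simp

lemma bilinear_times:
  assumes "bilinear K M N P \<beta>" "a \<in> carrier M" "b \<in> carrier N"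
  shows "bilinear K M N P (\<lambda>a' b'. \<beta> (a \<otimes>\<^bsub>M\<^esub> a') (b \<otimes>\<^bsub>N\<^esub> b'))"
  by (intro bilinear_compose[OF assms(1)] bilinear_right[OF bilinear_mult_left]
      bilinear_right[OF bilinear_mult_right] assms)

lemma pair_sum_products:
  assumes "module K P" "bilinear K M N P \<beta>" "xs \<in> formal_sums" "ys \<in> formal_sums"
  shows "pair_sum P \<beta> (products xs ys)
    = pair_sum P (\<lambda>a b. pair_sum P (\<lambda>a' b'. \<beta> (a \<otimes>\<^bsub>M\<^esub> a') (b \<otimes>\<^bsub>N\<^esub> b')) ys) xs"
  using assms(3)
proof (induction xs)
  case (Cons x xs)
  interpret P: module K P by fact
  obtain a b where x: "x = (a, b)" "a \<in> carrier M" "b \<in> carrier N" using Cons by (cases x) auto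
  show ?case
    using Cons x assms(4) bilinear_in[OF assms(2)]
    by (simp only: products_Cons)
      (simp add: pair_sum_append[OF P.abelian_group_axioms, of _ "carrier M" "carrier N"]
        products_formal_sums map_mult_formal_sums
        pair_sum_map[where f = "\<lambda>a' b'. a \<otimes>\<^bsub>M\<^esub> a'" and g = "\<lambda>a' b'. b \<otimes>\<^bsub>N\<^esub> b'"])
qed simp

lemma bilinear_lift_times:
  assumes P: "module K P" and \<beta>: "bilinear K M N P \<beta>" and U: "U \<in> carrier MN"
  shows "bilinear K M N P
    (\<lambda>a b. tensor_lift P (\<lambda>a' b'. \<beta> (a \<otimes>\<^bsub>M\<^esub> a') (b \<otimes>\<^bsub>N\<^esub> b')) U)"
proof (rule bilinearI)
  note * = module_hom_compose[OF bilinear_left[OF \<beta>] bilinear_left[OF bilinear_mult_left]]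
    module_hom_compose[OF bilinear_right[OF \<beta>] bilinear_left[OF bilinear_mult_right]]
    bilinear_in[OF bilinear_mult_left] bilinear_in[OF bilinear_mult_right]
  show "(\<lambda>a. tensor_lift P (\<lambda>a' b'. \<beta> (a \<otimes>\<^bsub>M\<^esub> a') (b \<otimes>\<^bsub>N\<^esub> b')) U) \<in> module_hom K M P"
    if "b \<in> carrier N" for b
    by (rule lift_param_hom[OF M.module_axioms P U bilinear_times[OF \<beta> _ that]])
      (auto intro: * that)
  show "(\<lambda>b. tensor_lift P (\<lambda>a' b'. \<beta> (a \<otimes>\<^bsub>M\<^esub> a') (b \<otimes>\<^bsub>N\<^esub> b')) U) \<in> module_hom K N P"
    if "a \<in> carrier M" for a
    by (rule lift_param_hom[OF N.module_axioms P U bilinear_times[OF \<beta> that]])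
      (auto intro: * that)
qed

text \<open>
  The product of two formal sums is, up to the congruence, the double sum of the pure tensors
  \<open>aa' \<otimes> bb'\<close>. For a fixed factor on one side this is the map induced by a bilinear map, so the
  universal property applies to each of the two arguments separately.
\<close>

lemma products_rel:
  assumes "(xs, xs') \<in> tensor_rel K M N" "(ys, ys') \<in> tensor_rel K M N"
  shows "tensor_class K M N (products xs ys) = tensor_class K M N (products xs' ys')"
proof -
  note fs = tensor_rel_formal_sums[OF assms(1)] tensor_rel_formal_sums[OF assms(2)]
  have *: "tensor_class K M N (products us vs)
    = pair_sum MN (\<lambda>a b. tensor_lift MN (\<lambda>a' b'. pure_tensor K M N (a \<otimes>\<^bsub>M\<^esub> a') (b \<otimes>\<^bsub>N\<^esub> b'))
        (tensor_class K M N vs)) us"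
    if "us \<in> formal_sums" "vs \<in> formal_sums" for us vs
    using that
    by (simp add: class_eq_pair_sum products_formal_sums
        pair_sum_products[OF tensor_module bilinear_pure])
      (intro pair_sum_cong, assumption,
        simp add: class_eq_pair_sum[symmetric] lift_class tensor_module bilinear_times[OF bilinear_pure])
  show ?thesis
    using fs class_eqI[OF assms(2)]
      pair_sum_rel[OF tensor_module bilinear_lift_times[OF tensor_module bilinear_pure] assms(1)]
    by (simp add: * class_closed)
qed

lemma mult_class:
  assumes "xs \<in> formal_sums" "ys \<in> formal_sums"
  shows "tensor_class K M N xs \<otimes>\<^bsub>MN\<^esub> tensor_class K M N ys = tensor_class K M N (products xs ys)"
proof -
  have "congruent2 (tensor_rel K M N) (tensor_rel K M N)
    (\<lambda>xs ys. tensor_class K M N (products xs ys))"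
    by (rule congruent2I') (rule products_rel)
  from UN_equiv_class2[OF equiv_tensor_rel equiv_tensor_rel this assms] show ?thesis
    by (simp add: tensor_def tensor_class_def)
qed

lemma tensor_mult_closed: "T \<in> carrier MN \<Longrightarrow> U \<in> carrier MN \<Longrightarrow> T \<otimes>\<^bsub>MN\<^esub> U \<in> carrier MN"
  by (elim tensor_carrierE) (simp add: mult_class class_closed products_formal_sums)

lemma lift_mult:
  assumes P: "module K P" and \<beta>: "bilinear K M N P \<beta>"
    and "T \<in> carrier MN" "U \<in> carrier MN"
  shows "tensor_lift P \<beta> (T \<otimes>\<^bsub>MN\<^esub> U)
    = tensor_lift P (\<lambda>a b. tensor_lift P (\<lambda>a' b'. \<beta> (a \<otimes>\<^bsub>M\<^esub> a') (b \<otimes>\<^bsub>N\<^esub> b')) U) T"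
proof -
  obtain xs ys where xs: "xs \<in> formal_sums" "T = tensor_class K M N xs"
    and ys: "ys \<in> formal_sums" "U = tensor_class K M N ys"
    using assms(3,4) by (elim tensor_carrierE) blast
  have "tensor_lift P (\<lambda>a b. tensor_lift P (\<lambda>a' b'. \<beta> (a \<otimes>\<^bsub>M\<^esub> a') (b \<otimes>\<^bsub>N\<^esub> b')) U) T
    = pair_sum P (\<lambda>a b. tensor_lift P (\<lambda>a' b'. \<beta> (a \<otimes>\<^bsub>M\<^esub> a') (b \<otimes>\<^bsub>N\<^esub> b')) U) xs"
    unfolding xs(2) by (rule lift_class[OF P bilinear_lift_times[OF P \<beta> assms(4)] xs(1)])
  also have "\<dots> = pair_sum P \<beta> (products xs ys)"
    unfolding pair_sum_products[OF P \<beta> xs(1) ys(1)] ys(2)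
    by (intro pair_sum_cong[OF xs(1)]) (simp add: lift_class[OF P bilinear_times[OF \<beta>] ys(1)])
  also have "\<dots> = tensor_lift P \<beta> (T \<otimes>\<^bsub>MN\<^esub> U)"
    using xs ys by (simp add: mult_class lift_class[OF P \<beta>] products_formal_sums)
  finally show ?thesis ..
qed

lemma products_append: "products (xs @ ys) zs = products xs zs @ products ys zs"
  by (induction xs) simp_all

lemma products_map:
  assumes "Group.monoid M" "Group.monoid N" "a \<in> carrier M" "b \<in> carrier N"
    "xs \<in> formal_sums" "ys \<in> formal_sums"
  shows "products (map (\<lambda>(a', b'). (a \<otimes>\<^bsub>M\<^esub> a', b \<otimes>\<^bsub>N\<^esub> b')) xs) ys
    = map (\<lambda>(a', b'). (a \<otimes>\<^bsub>M\<^esub> a', b \<otimes>\<^bsub>N\<^esub> b')) (products xs ys)"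
proof -
  interpret M: Group.monoid M by fact
  interpret N: Group.monoid N by fact
  have *: "map (\<lambda>(a'', b''). (a \<otimes>\<^bsub>M\<^esub> a' \<otimes>\<^bsub>M\<^esub> a'', b \<otimes>\<^bsub>N\<^esub> b' \<otimes>\<^bsub>N\<^esub> b'')) zs
    = map (\<lambda>(a', b'). (a \<otimes>\<^bsub>M\<^esub> a', b \<otimes>\<^bsub>N\<^esub> b')) (map (\<lambda>(a'', b''). (a' \<otimes>\<^bsub>M\<^esub> a'', b' \<otimes>\<^bsub>N\<^esub> b'')) zs)"
    if "a' \<in> carrier M" "b' \<in> carrier N" "zs \<in> formal_sums" for a' b' zs
    using that(3,1,2) assms(3,4) by (induction zs) (auto simp: M.m_assoc N.m_assoc)
  show ?thesis
    using assms(5)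
  proof (induction xs)
    case (Cons x xs)
    then show ?case
      using assms(6) by (cases x) (simp add: products_Cons * del: map_map product.simps)
  qed simp
qed

text \<open>
  \<open>List.product\<close> enumerates lexicographically, so both bracketings list the triple products in the
  same order; the two formal sums are equal and not only congruent.
\<close>

lemma products_assoc:
  assumes "Group.monoid M" "Group.monoid N"
    "xs \<in> formal_sums" "ys \<in> formal_sums" "zs \<in> formal_sums"
  shows "products (products xs ys) zs = products xs (products ys zs)"
  using assms(3)
proof (induction xs)
  case (Cons x xs)
  then show ?case
    using assms(4,5)
    by (cases x)
      (simp add: products_Cons products_append products_map[OF assms(1,2)] del: map_map product.simps)
qed simp

lemma tensor_monoid:
  assumes "Group.monoid M" "Group.monoid N"
  shows "Group.monoid MN"
proof -
  interpret M: Group.monoid M by fact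
  interpret N: Group.monoid N by fact
  have one: "\<one>\<^bsub>MN\<^esub> = tensor_class K M N [(\<one>\<^bsub>M\<^esub>, \<one>\<^bsub>N\<^esub>)]"
    by (simp add: tensor_def pure_tensor_def)
  have units: "products [(\<one>\<^bsub>M\<^esub>, \<one>\<^bsub>N\<^esub>)] xs = xs" "products xs [(\<one>\<^bsub>M\<^esub>, \<one>\<^bsub>N\<^esub>)] = xs"
    if "xs \<in> formal_sums" for xs
    using that by (induction xs) auto
  show ?thesis
  proof (rule monoidI)
    show "\<one>\<^bsub>MN\<^esub> \<in> carrier MN" unfolding one by (rule class_closed) simp
  next
    fix S T U assume "S \<in> carrier MN" "T \<in> carrier MN" "U \<in> carrier MN"
    then obtain xs ys zs where "xs \<in> formal_sums" "S = tensor_class K M N xs"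
      "ys \<in> formal_sums" "T = tensor_class K M N ys" "zs \<in> formal_sums" "U = tensor_class K M N zs"
      by (elim tensor_carrierE) blast
    then show "S \<otimes>\<^bsub>MN\<^esub> T \<otimes>\<^bsub>MN\<^esub> U = S \<otimes>\<^bsub>MN\<^esub> (T \<otimes>\<^bsub>MN\<^esub> U)"
      by (simp add: mult_class products_formal_sums products_assoc[OF assms])
  next
    fix S assume "S \<in> carrier MN"
    then obtain xs where "xs \<in> formal_sums" "S = tensor_class K M N xs"
      by (elim tensor_carrierE) blast
    then show "\<one>\<^bsub>MN\<^esub> \<otimes>\<^bsub>MN\<^esub> S = S" "S \<otimes>\<^bsub>MN\<^esub> \<one>\<^bsub>MN\<^esub> = S"
      unfolding one by (simp_all add: mult_class units del: product.simps)
  qed (rule tensor_mult_closed)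
qed

lemma pure_mult:
  assumes "a \<in> carrier M" "b \<in> carrier N" "U \<in> carrier MN"
  shows "pure_tensor K M N a b \<otimes>\<^bsub>MN\<^esub> U
    = tensor_lift MN (\<lambda>a' b'. pure_tensor K M N (a \<otimes>\<^bsub>M\<^esub> a') (b \<otimes>\<^bsub>N\<^esub> b')) U"
  using lift_mult[OF tensor_module bilinear_pure pure_closed[OF assms(1,2)] assms(3)]
  by (simp add: lift_pure_tensor tensor_mult_closed pure_closed assms lift_pure[OF tensor_module
        bilinear_lift_times[OF tensor_module bilinear_pure assms(3)]])

lemma mult_pure:
  assumes "a \<in> carrier M" "b \<in> carrier N" "U \<in> carrier MN"
  shows "U \<otimes>\<^bsub>MN\<^esub> pure_tensor K M N a b
    = tensor_lift MN (\<lambda>a' b'. pure_tensor K M N (a' \<otimes>\<^bsub>M\<^esub> a) (b' \<otimes>\<^bsub>N\<^esub> b)) U"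
proof -
  have "U \<otimes>\<^bsub>MN\<^esub> pure_tensor K M N a b
    = tensor_lift MN (\<lambda>a' b'. tensor_lift MN
        (\<lambda>a'' b''. pure_tensor K M N (a' \<otimes>\<^bsub>M\<^esub> a'') (b' \<otimes>\<^bsub>N\<^esub> b'')) (pure_tensor K M N a b)) U"
    using lift_mult[OF tensor_module bilinear_pure assms(3) pure_closed[OF assms(1,2)]]
    by (simp add: lift_pure_tensor tensor_mult_closed pure_closed assms)
  also have "\<dots> = tensor_lift MN (\<lambda>a' b'. pure_tensor K M N (a' \<otimes>\<^bsub>M\<^esub> a) (b' \<otimes>\<^bsub>N\<^esub> b)) U"
    by (rule lift_cong[OF assms(3)])
      (rule lift_pure[OF tensor_module bilinear_times[OF bilinear_pure] assms(1,2)])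
  finally show ?thesis .
qed

end

lemma (in unital_assoc_algebra) bilinear_mult: "bilinear K A A A (mult A)"
  by (intro bilinearI module_homI)
    (auto simp: Alg.l_distr Alg.r_distr smult_mult_left smult_mult_right)

section \<open>Dual bases\<close>

text \<open>
  The list pairs each vector of a basis with its coordinate functional; these functionals are linear
  because coordinates are unique.
\<close>

lemma (in vectorspace) finite_dual_basis:
  assumes "fin_dim"
  shows "\<exists>bs \<in> lists (carrier V \<times> module_hom K V (self_module K)).
    \<forall>v\<in>carrier V. v = pair_sum V (\<lambda>e \<phi>. \<phi> v \<odot>\<^bsub>V\<^esub> e) bs"
proof -
  obtain A where A: "finite A" "basis A" using finite_basis_exists[OF assms] by auto
  then have AV: "A \<subseteq> carrier V" by (simp add: basis_def)
  have ex1: "\<exists>!a. a \<in> A \<rightarrow>\<^sub>E carrier K \<and> lincomb a A = v" if "v \<in> carrier V" for v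
    using basis_criterion[OF A(1) AV] A(2) that by simp
  define coord where "coord v = (THE a. a \<in> A \<rightarrow>\<^sub>E carrier K \<and> lincomb a A = v)" for v
  have coord: "coord v \<in> A \<rightarrow>\<^sub>E carrier K" "lincomb (coord v) A = v" if "v \<in> carrier V" for v
    using theI'[OF ex1[OF that]] by (auto simp: coord_def)
  have coordI: "coord v e = a e"
    if "v \<in> carrier V" "a \<in> A \<rightarrow> carrier K" "lincomb a A = v" "e \<in> A" for a v e
  proof -
    have "lincomb (restrict a A) A = lincomb a A" using AV that(2) by (intro lincomb_cong) auto
    then have "restrict a A = coord v"
      using ex1[OF that(1)] coord[OF that(1)] that(2,3) by (metis restrict_PiE)
    then show ?thesis using that(4) by (metis restrict_apply')
  qed
  have coordK: "coord v e \<in> carrier K" if "v \<in> carrier V" "e \<in> A" for v e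
    using coord(1)[OF that(1)] that(2) by auto
  have hom: "(\<lambda>v. coord v e) \<in> module_hom K V (self_module K)" if e: "e \<in> A" for e
  proof (rule module_homI, goal_cases)
    case (1 v)
    then show ?case using coordK e by simp
  next
    case (2 v w)
    have "coord (v \<oplus>\<^bsub>V\<^esub> w) e = coord v e \<oplus>\<^bsub>K\<^esub> coord w e"
      using 2 coord e coordK by (intro coordI) (auto simp: lincomb_sum[OF A(1) AV])
    then show ?case by simp
  next
    case (3 c v)
    have "coord (c \<odot>\<^bsub>V\<^esub> v) e = c \<otimes>\<^bsub>K\<^esub> coord v e"
      using 3 coord e coordK by (intro coordI) (auto simp: lincomb_smult[OF AV])
    then show ?case by simp
  qed
  obtain es where es: "set es = A" "distinct es" using finite_distinct_list[OF A(1)] by auto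
  have sum: "pair_sum V (\<lambda>e \<phi>. \<phi> v \<odot>\<^bsub>V\<^esub> e) (map (\<lambda>e. (e, \<lambda>v. coord v e)) xs)
    = (\<Oplus>\<^bsub>V\<^esub>e\<in>set xs. coord v e \<odot>\<^bsub>V\<^esub> e)"
    if "v \<in> carrier V" "distinct xs" "set xs \<subseteq> A" for v xs
    using that(2,3)
  proof (induction xs)
    case (Cons x xs)
    have "coord v e \<odot>\<^bsub>V\<^esub> e \<in> carrier V" if "e \<in> A" for e
      using coordK[OF \<open>v \<in> carrier V\<close> that] AV that by auto
    then have "(\<lambda>e. coord v e \<odot>\<^bsub>V\<^esub> e) \<in> set xs \<rightarrow> carrier V" "coord v x \<odot>\<^bsub>V\<^esub> x \<in> carrier V"
      using Cons.prems by auto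
    then show ?case using Cons by simp
  qed simp
  show ?thesis
  proof (rule bexI[where x = "map (\<lambda>e. (e, \<lambda>v. coord v e)) es"])
    show "\<forall>v\<in>carrier V. v = pair_sum V (\<lambda>e \<phi>. \<phi> v \<odot>\<^bsub>V\<^esub> e) (map (\<lambda>e. (e, \<lambda>v. coord v e)) es)"
      using coord(2) es by (simp add: sum) (simp add: lincomb_def)
    show "map (\<lambda>e. (e, \<lambda>v. coord v e)) es \<in> lists (carrier V \<times> module_hom K V (self_module K))"
      using es AV hom by (auto simp: in_lists_conv_set)
  qed
qed

section \<open>Sweedler calculus\<close>

context weak_hopf_algebra
begin

abbreviation "\<Delta> \<equiv> comult H"
abbreviation "\<epsilon> \<equiv> counit H"
abbreviation "S \<equiv> antipode H"
abbreviation "HH \<equiv> tensor K H H"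

lemma H_module: "module K H" ..

lemma two_modules_H_H: "two_modules K H H"
  by (intro two_modules.intro H_module)

sublocale HH: two_multiplicative_modules K H H
  by (intro two_multiplicative_modules.intro two_multiplicative_modules_axioms.intro
      two_modules_H_H bilinear_mult)

lemma two_modules_H_HH: "two_modules K H HH"
  by (intro two_modules.intro H_module HH.tensor_module)

lemma two_modules_HH_H: "two_modules K HH H"
  by (intro two_modules.intro H_module HH.tensor_module)

lemma monoid_HH: "Group.monoid HH"
  by (intro HH.tensor_monoid Alg.monoid_axioms)

lemma module_K: "module K (self_module K)"
  by (intro self_module_module module.axioms(1)[OF H_module])

lemma comult_closed: "h \<in> carrier H \<Longrightarrow> \<Delta> h \<in> carrier HH"
  by (rule module_hom_in[OF comult_linear])

lemma counit_closed: "h \<in> carrier H \<Longrightarrow> \<epsilon> h \<in> carrier K"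
  using module_hom_in[OF counit_linear] by simp

lemma antipode_closed: "h \<in> carrier H \<Longrightarrow> S h \<in> carrier H"
  by (rule module_hom_in[OF antipode_linear])

lemma sweedler_hom:
  "module K P \<Longrightarrow> bilinear K H H P \<beta> \<Longrightarrow> (\<lambda>h. tensor_lift P \<beta> (\<Delta> h)) \<in> module_hom K H P"
  by (intro module_hom_compose[OF HH.lift_hom comult_linear])

lemma bilinear_mult_compose:
  "\<phi> \<in> module_hom K M H \<Longrightarrow> \<psi> \<in> module_hom K N H \<Longrightarrow> bilinear K M N H (\<lambda>a b. \<phi> a \<otimes>\<^bsub>H\<^esub> \<psi> b)"
  by (rule bilinear_compose[OF bilinear_mult])

lemma bilinear_smult_compose:
  "\<phi> \<in> module_hom K M (self_module K) \<Longrightarrow> \<psi> \<in> module_hom K N H \<Longrightarrow>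
    bilinear K M N H (\<lambda>a b. \<phi> a \<odot>\<^bsub>H\<^esub> \<psi> b)"
  by (rule bilinear_compose[OF bilinear_smult[OF H_module]])

lemma K_commute: "x \<in> carrier K \<Longrightarrow> y \<in> carrier K \<Longrightarrow> x \<otimes>\<^bsub>K\<^esub> y = y \<otimes>\<^bsub>K\<^esub> x"
  by (rule cring.cring_simprules(14)[OF module.axioms(1)[OF H_module]])

text \<open>
  Coassociativity in the form in which Sweedler notation uses it: a trilinear \<open>\<beta>\<close> may be evaluated on
  \<open>h\<^sub>(\<^sub>1\<^sub>) \<otimes> h\<^sub>(\<^sub>2\<^sub>) \<otimes> h\<^sub>(\<^sub>3\<^sub>)\<close> by splitting either leg of \<open>\<Delta>(h)\<close>. The map \<open>F\<close> below is the linear map on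
  \<open>H \<otimes> (H \<otimes> H)\<close> induced by \<open>\<beta>\<close>; applying it to both sides of the axiom gives the claim.
\<close>

lemma coassoc_lift:
  assumes P: "module K P" and h: "h \<in> carrier H"
    and \<beta>1: "\<And>b c. b \<in> carrier H \<Longrightarrow> c \<in> carrier H \<Longrightarrow> (\<lambda>a. \<beta> a b c) \<in> module_hom K H P"
    and \<beta>2: "\<And>a c. a \<in> carrier H \<Longrightarrow> c \<in> carrier H \<Longrightarrow> (\<lambda>b. \<beta> a b c) \<in> module_hom K H P"
    and \<beta>3: "\<And>a b. a \<in> carrier H \<Longrightarrow> b \<in> carrier H \<Longrightarrow> (\<lambda>c. \<beta> a b c) \<in> module_hom K H P"
  shows "tensor_lift P (\<lambda>x c. tensor_lift P (\<lambda>a b. \<beta> a b c) (\<Delta> x)) (\<Delta> h)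
    = tensor_lift P (\<lambda>a x. tensor_lift P (\<lambda>b c. \<beta> a b c) (\<Delta> x)) (\<Delta> h)"
proof -
  interpret H_HH: two_modules K H HH by (rule two_modules_H_HH)
  interpret HH_H: two_modules K HH H by (rule two_modules_HH_H)
  define B where "B a t = tensor_lift P (\<beta> a) t" for a t
  \<comment> \<open>the bilinear map that underlies the associator\<close>
  define A where "A t c = tensor_lift H_HH.MN
    (\<lambda>a b. pure_tensor K H HH a (pure_tensor K H H b c)) t" for t c
  define F where "F = tensor_lift P B"
  have \<beta>: "bilinear K H H P (\<beta> a)" if "a \<in> carrier H" for a
    by (intro bilinearI \<beta>2 \<beta>3 that)
  have B: "bilinear K H HH P B"
    unfolding B_def[abs_def]
    by (intro bilinearI HH.lift_hom[OF P] HH.lift_param_hom[OF H_module P] \<beta> \<beta>1)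
  have pp: "bilinear K H H H_HH.MN (\<lambda>a b. pure_tensor K H HH a (pure_tensor K H H b c))"
    if "c \<in> carrier H" for c
    by (rule bilinear_compose[OF H_HH.bilinear_pure module_hom_ident
          bilinear_left[OF HH.bilinear_pure that]])
  have A: "bilinear K HH H H_HH.MN A"
    unfolding A_def[abs_def]
    by (intro bilinearI HH.lift_hom[OF H_HH.tensor_module] pp
        HH.lift_param_hom[OF H_module H_HH.tensor_module]
        module_hom_compose[OF bilinear_right[OF H_HH.bilinear_pure] bilinear_right[OF HH.bilinear_pure]])
  have F: "F \<in> module_hom K H_HH.MN P"
    unfolding F_def by (rule H_HH.lift_hom[OF P B])
  have FA: "F (A (\<Delta> x) c) = tensor_lift P (\<lambda>a b. \<beta> a b c) (\<Delta> x)"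
    if x: "x \<in> carrier H" and c: "c \<in> carrier H" for x c
  proof -
    have "F (A (\<Delta> x) c)
      = tensor_lift P (\<lambda>a b. F (pure_tensor K H HH a (pure_tensor K H H b c))) (\<Delta> x)"
      unfolding A_def
      by (rule HH.hom_lift[OF H_HH.tensor_module P F pp[OF c] comult_closed[OF x]])
    also have "\<dots> = tensor_lift P (\<lambda>a b. \<beta> a b c) (\<Delta> x)"
      by (rule HH.lift_cong[OF comult_closed[OF x]])
        (simp add: F_def H_HH.lift_pure[OF P B] HH.pure_closed c B_def HH.lift_pure[OF P \<beta>])
    finally show ?thesis .
  qed
  have "tensor_lift P (\<lambda>x c. tensor_lift P (\<lambda>a b. \<beta> a b c) (\<Delta> x)) (\<Delta> h)
    = tensor_lift P (\<lambda>x c. F (A (\<Delta> x) c)) (\<Delta> h)"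
    by (rule HH.lift_cong[OF comult_closed[OF h]]) (simp add: FA)
  also have "\<dots> = F (tensor_lift H_HH.MN (\<lambda>x c. A (\<Delta> x) c) (\<Delta> h))"
    by (rule HH.hom_lift[symmetric, OF H_HH.tensor_module P F
          bilinear_compose[OF A comult_linear module_hom_ident] comult_closed[OF h]])
  also have "\<dots> = F (tensor_lift H_HH.MN A (tensor_map K HH H \<Delta> (\<lambda>x. x) (\<Delta> h)))"
    by (simp only: HH.lift_tensor_map[OF two_modules_HH_H comult_linear module_hom_ident
          comult_closed[OF h] H_HH.tensor_module A])
  also have "tensor_lift H_HH.MN A (tensor_map K HH H \<Delta> (\<lambda>x. x) (\<Delta> h))
    = tensor_map K H HH (\<lambda>x. x) \<Delta> (\<Delta> h)"
    using coassoc[OF h] by (simp add: tensor_assoc_def Let_def A_def[abs_def])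
  also have "F \<dots> = tensor_lift P (\<lambda>a x. B a (\<Delta> x)) (\<Delta> h)"
    unfolding F_def
    by (rule HH.lift_tensor_map[OF two_modules_H_HH module_hom_ident comult_linear
          comult_closed[OF h] P B])
  finally show ?thesis by (simp add: B_def)
qed

section \<open>Convolution and the counital maps\<close>

definition convolution :: "('h \<Rightarrow> 'h) \<Rightarrow> ('h \<Rightarrow> 'h) \<Rightarrow> 'h \<Rightarrow> 'h"
  where "convolution \<phi> \<psi> h = tensor_lift H (\<lambda>a b. \<phi> a \<otimes>\<^bsub>H\<^esub> \<psi> b) (\<Delta> h)"

lemma convolution_cong:
  assumes "\<And>x. x \<in> carrier H \<Longrightarrow> \<phi> x = \<phi>' x" "\<And>x. x \<in> carrier H \<Longrightarrow> \<psi> x = \<psi>' x" "h \<in> carrier H"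
  shows "convolution \<phi> \<psi> h = convolution \<phi>' \<psi>' h"
  unfolding convolution_def by (rule HH.lift_cong) (simp_all add: assms comult_closed)

lemma convolution_hom:
  assumes "\<phi> \<in> module_hom K H H" "\<psi> \<in> module_hom K H H"
  shows "convolution \<phi> \<psi> \<in> module_hom K H H"
  unfolding convolution_def[abs_def]
  by (intro sweedler_hom H_module bilinear_mult_compose assms)

lemma convolution_assoc:
  assumes \<phi>: "\<phi> \<in> module_hom K H H" and \<psi>: "\<psi> \<in> module_hom K H H"
    and \<chi>: "\<chi> \<in> module_hom K H H" and h: "h \<in> carrier H"
  shows "convolution (convolution \<phi> \<psi>) \<chi> h = convolution \<phi> (convolution \<psi> \<chi>) h"
proof -
  note [simp] = module_hom_in[OF \<phi>] module_hom_in[OF \<psi>] module_hom_in[OF \<chi>]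
  have "convolution (convolution \<phi> \<psi>) \<chi> h
    = tensor_lift H (\<lambda>x c. tensor_lift H (\<lambda>a b. \<phi> a \<otimes>\<^bsub>H\<^esub> \<psi> b \<otimes>\<^bsub>H\<^esub> \<chi> c) (\<Delta> x)) (\<Delta> h)"
    unfolding convolution_def
    by (intro HH.lift_cong comult_closed h
        HH.hom_lift[OF H_module H_module bilinear_left[OF bilinear_mult]]
        bilinear_mult_compose \<phi> \<psi>) simp
  also have "\<dots> = tensor_lift H (\<lambda>a x. tensor_lift H (\<lambda>b c. \<phi> a \<otimes>\<^bsub>H\<^esub> \<psi> b \<otimes>\<^bsub>H\<^esub> \<chi> c) (\<Delta> x)) (\<Delta> h)"
    by (intro coassoc_lift H_module h module_hom_compose[OF bilinear_left[OF bilinear_mult]]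
        module_hom_compose[OF bilinear_right[OF bilinear_mult]] \<phi> \<psi> \<chi>) simp_all
  also have "\<dots> = convolution \<phi> (convolution \<psi> \<chi>) h"
    unfolding convolution_def
  proof (intro HH.lift_cong comult_closed h)
    fix a x assume a: "a \<in> carrier H" and x: "x \<in> carrier H"
    have "\<phi> a \<otimes>\<^bsub>H\<^esub> tensor_lift H (\<lambda>b c. \<psi> b \<otimes>\<^bsub>H\<^esub> \<chi> c) (\<Delta> x)
      = tensor_lift H (\<lambda>b c. \<phi> a \<otimes>\<^bsub>H\<^esub> (\<psi> b \<otimes>\<^bsub>H\<^esub> \<chi> c)) (\<Delta> x)"
      by (intro comult_closed x bilinear_mult_compose \<psi> \<chi>
          HH.hom_lift[OF H_module H_module bilinear_right[OF bilinear_mult]])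
        (simp add: a)
    also have "\<dots> = tensor_lift H (\<lambda>b c. \<phi> a \<otimes>\<^bsub>H\<^esub> \<psi> b \<otimes>\<^bsub>H\<^esub> \<chi> c) (\<Delta> x)"
      by (intro HH.lift_cong comult_closed x) (simp add: a Alg.m_assoc)
    finally show "tensor_lift H (\<lambda>b c. \<phi> a \<otimes>\<^bsub>H\<^esub> \<psi> b \<otimes>\<^bsub>H\<^esub> \<chi> c) (\<Delta> x)
      = \<phi> a \<otimes>\<^bsub>H\<^esub> tensor_lift H (\<lambda>b c. \<psi> b \<otimes>\<^bsub>H\<^esub> \<chi> c) (\<Delta> x)" ..
  qed
  finally show ?thesis .
qed

lemma antipode_convolution': "h \<in> carrier H \<Longrightarrow> convolution (convolution S (\<lambda>x. x)) S h = S h"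
  using antipode_convolution[of h]
    HH.lift_tensor_map[OF two_modules_HH_H comult_linear module_hom_ident comult_closed[of h]
      H_module bilinear_mult_compose[OF HH.lift_hom[OF H_module
          bilinear_mult_compose[OF antipode_linear module_hom_ident]] antipode_linear]]
  by (simp add: convolution_def)

text \<open>
  This formula and the next do not mention the antipode on the right. That is what makes the antipode
  unique: the values of \<open>h\<^sub>(\<^sub>1\<^sub>) S(h\<^sub>(\<^sub>2\<^sub>))\<close> and \<open>S(h\<^sub>(\<^sub>1\<^sub>)) h\<^sub>(\<^sub>2\<^sub>)\<close> are fixed by the rest of the structure.
\<close>

lemma target_counital:
  assumes h: "h \<in> carrier H"
  shows "convolution (\<lambda>x. x) S h = tensor_lift H (\<lambda>a b. \<epsilon> (a \<otimes>\<^bsub>H\<^esub> h) \<odot>\<^bsub>H\<^esub> b) (\<Delta> \<one>\<^bsub>H\<^esub>)"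
proof -
  note \<epsilon> = bilinear_smult_compose[OF counit_linear module_hom_ident]
  have "convolution (\<lambda>x. x) S h = tensor_lift H (\<lambda>a b. tensor_lift H
    (\<lambda>a' b'. \<epsilon> (a \<otimes>\<^bsub>H\<^esub> a') \<odot>\<^bsub>H\<^esub> (b \<otimes>\<^bsub>H\<^esub> b')) (pure_tensor K H H h \<one>\<^bsub>H\<^esub>)) (\<Delta> \<one>\<^bsub>H\<^esub>)"
    unfolding convolution_def antipode_right[OF h]
    by (intro HH.lift_mult[OF H_module \<epsilon>] comult_closed HH.pure_closed h Alg.one_closed)
  also have "\<dots> = tensor_lift H (\<lambda>a b. \<epsilon> (a \<otimes>\<^bsub>H\<^esub> h) \<odot>\<^bsub>H\<^esub> b) (\<Delta> \<one>\<^bsub>H\<^esub>)"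
    by (intro HH.lift_cong comult_closed Alg.one_closed)
      (simp add: HH.lift_pure[OF H_module HH.bilinear_times[OF \<epsilon>]] h)
  finally show ?thesis .
qed

lemma source_counital:
  assumes h: "h \<in> carrier H"
  shows "convolution S (\<lambda>x. x) h = tensor_lift H (\<lambda>a b. \<epsilon> (h \<otimes>\<^bsub>H\<^esub> b) \<odot>\<^bsub>H\<^esub> a) (\<Delta> \<one>\<^bsub>H\<^esub>)"
proof -
  note \<epsilon> = bilinear_flip[OF bilinear_smult_compose[OF counit_linear module_hom_ident]]
  have "convolution S (\<lambda>x. x) h = tensor_lift H (\<lambda>a b. tensor_lift H
    (\<lambda>a' b'. \<epsilon> (b \<otimes>\<^bsub>H\<^esub> b') \<odot>\<^bsub>H\<^esub> (a \<otimes>\<^bsub>H\<^esub> a')) (\<Delta> \<one>\<^bsub>H\<^esub>)) (pure_tensor K H H \<one>\<^bsub>H\<^esub> h)"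
    unfolding convolution_def antipode_left[OF h]
    by (intro HH.lift_mult[OF H_module \<epsilon>] comult_closed HH.pure_closed h Alg.one_closed)
  also have "\<dots> = tensor_lift H (\<lambda>a' b'. \<epsilon> (h \<otimes>\<^bsub>H\<^esub> b') \<odot>\<^bsub>H\<^esub> (\<one>\<^bsub>H\<^esub> \<otimes>\<^bsub>H\<^esub> a')) (\<Delta> \<one>\<^bsub>H\<^esub>)"
    by (intro HH.lift_pure[OF H_module HH.bilinear_lift_times[OF H_module \<epsilon>]]
        comult_closed h Alg.one_closed)
  also have "\<dots> = tensor_lift H (\<lambda>a b. \<epsilon> (h \<otimes>\<^bsub>H\<^esub> b) \<odot>\<^bsub>H\<^esub> a) (\<Delta> \<one>\<^bsub>H\<^esub>)"
    by (intro HH.lift_cong comult_closed Alg.one_closed) simp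
  finally show ?thesis .
qed

section \<open>Automorphisms\<close>

text \<open>
  The unit, the counit and the antipode are determined by the multiplication and the
  comultiplication, so a bijection that respects the latter two is an automorphism.

  Counit: \<open>\<epsilon> \<circ> f\<close> is a left counit, because \<open>f\<close> maps \<open>\<epsilon>(f(h\<^sub>(\<^sub>1\<^sub>))) h\<^sub>(\<^sub>2\<^sub>)\<close> to
  \<open>\<epsilon>(f(h)\<^sub>(\<^sub>1\<^sub>)) f(h)\<^sub>(\<^sub>2\<^sub>) = f(h)\<close> and is injective; a left counit and a right counit agree.

  Antipode: with \<open>*\<close> for convolution, \<open>T = S \<circ> f\<close> and \<open>U = f \<circ> S\<close> satisfy \<open>f * T = f * U\<close> and
  \<open>T * f = U * f\<close>, since the counital maps commute with \<open>f\<close>. Moreover \<open>T * f * T = T\<close> and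
  \<open>U * f * U = U\<close>. Hence \<open>U = U * f * U = T * f * U = T * f * T = T\<close>.
\<close>

lemma weak_hopf_autoI:
  assumes f: "f \<in> module_hom K H H" and bij: "bij_betw f (carrier H) (carrier H)"
    and mult: "\<And>x y. x \<in> carrier H \<Longrightarrow> y \<in> carrier H \<Longrightarrow> f (x \<otimes>\<^bsub>H\<^esub> y) = f x \<otimes>\<^bsub>H\<^esub> f y"
    and comult: "\<And>h. h \<in> carrier H \<Longrightarrow> \<Delta> (f h) = tensor_map K H H f f (\<Delta> h)"
  shows "f \<in> weak_hopf_auto K H"
proof -
  note [simp] = module_hom_in[OF f] antipode_closed counit_closed comult_closed
  \<comment> \<open>the image of the unit is a unit for the image of \<open>f\<close>, which is everything\<close>
  have one: "f \<one>\<^bsub>H\<^esub> = \<one>\<^bsub>H\<^esub>"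
  proof -
    obtain u where "u \<in> carrier H" "f u = \<one>\<^bsub>H\<^esub>"
      using bij Alg.one_closed unfolding bij_betw_def by (metis imageE)
    then show ?thesis using mult[of "\<one>\<^bsub>H\<^esub>" u] by simp
  qed
  have lift_comult: "tensor_lift P \<beta> (\<Delta> (f h)) = tensor_lift P (\<lambda>a b. \<beta> (f a) (f b)) (\<Delta> h)"
    if "module K P" "bilinear K H H P \<beta>" "h \<in> carrier H" for P \<beta> h
    using HH.lift_tensor_map[OF two_modules_H_H f f _ that(1,2), of "\<Delta> h"] that(3)
    by (simp add: comult)
  have f_lift: "f (tensor_lift H \<beta> (\<Delta> h)) = tensor_lift H (\<lambda>a b. f (\<beta> a b)) (\<Delta> h)"
    if "bilinear K H H H \<beta>" "h \<in> carrier H" for \<beta> h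
    using HH.hom_lift[OF H_module H_module f that(1)] that(2) by simp
  have cong: "tensor_lift P \<beta> (\<Delta> h) = tensor_lift P \<beta>' (\<Delta> h)"
    if "h \<in> carrier H" "\<And>a b. a \<in> carrier H \<Longrightarrow> b \<in> carrier H \<Longrightarrow> \<beta> a b = \<beta>' a b"
    for P :: "('p, 'q) ring_scheme" and \<beta> \<beta>' h
    using that by (intro HH.lift_cong) simp_all
  have \<epsilon>f: "(\<lambda>h. \<epsilon> (f h)) \<in> module_hom K H (self_module K)"
    by (rule module_hom_compose[OF counit_linear f])
  have counit: "\<epsilon> (f h) = \<epsilon> h" if h: "h \<in> carrier H" for h
  proof -
    have "f (tensor_lift H (\<lambda>a b. \<epsilon> (f a) \<odot>\<^bsub>H\<^esub> b) (\<Delta> h))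
      = tensor_lift H (\<lambda>a b. \<epsilon> (f a) \<odot>\<^bsub>H\<^esub> f b) (\<Delta> h)"
      using h by (subst f_lift[OF bilinear_smult_compose[OF \<epsilon>f module_hom_ident] h])
        (intro cong, simp_all add: module_hom_smult[OF f])
    also have "\<dots> = tensor_lift H (\<lambda>a b. \<epsilon> a \<odot>\<^bsub>H\<^esub> b) (\<Delta> (f h))"
      by (rule lift_comult[symmetric, OF H_module
            bilinear_smult_compose[OF counit_linear module_hom_ident] h])
    also have "\<dots> = f h" using h by (simp add: counit_left)
    finally have "f (tensor_lift H (\<lambda>a b. \<epsilon> (f a) \<odot>\<^bsub>H\<^esub> b) (\<Delta> h)) = f h" .
    moreover have "tensor_lift H (\<lambda>a b. \<epsilon> (f a) \<odot>\<^bsub>H\<^esub> b) (\<Delta> h) \<in> carrier H"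
      using h by (intro HH.lift_closed H_module bilinear_smult_compose \<epsilon>f module_hom_ident) simp
    ultimately have left: "tensor_lift H (\<lambda>a b. \<epsilon> (f a) \<odot>\<^bsub>H\<^esub> b) (\<Delta> h) = h"
      using bij h by (auto simp: bij_betw_def dest: inj_onD)
    have "\<epsilon> (f h) = \<epsilon> (f (tensor_lift H (\<lambda>a b. \<epsilon> b \<odot>\<^bsub>H\<^esub> a) (\<Delta> h)))"
      using h by (simp add: counit_right)
    also have "\<dots> = tensor_lift (self_module K) (\<lambda>a b. \<epsilon> (f (\<epsilon> b \<odot>\<^bsub>H\<^esub> a))) (\<Delta> h)"
      using h by (intro HH.hom_lift H_module module_K \<epsilon>f
          bilinear_flip[OF bilinear_smult_compose] counit_linear module_hom_ident) simp
    also have "\<dots> = tensor_lift (self_module K) (\<lambda>a b. \<epsilon> (\<epsilon> (f a) \<odot>\<^bsub>H\<^esub> b)) (\<Delta> h)"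
      using h
      by (intro cong)
        (simp_all add: module_hom_smult[OF \<epsilon>f] module_hom_smult[OF counit_linear] K_commute)
    also have "\<dots> = \<epsilon> (tensor_lift H (\<lambda>a b. \<epsilon> (f a) \<odot>\<^bsub>H\<^esub> b) (\<Delta> h))"
      using h by (intro HH.hom_lift[symmetric] H_module module_K counit_linear
          bilinear_smult_compose \<epsilon>f module_hom_ident) simp
    finally show ?thesis using left by simp
  qed
  have target: "convolution (\<lambda>x. x) S (f h) = f (convolution (\<lambda>x. x) S h)"
    and source: "convolution S (\<lambda>x. x) (f h) = f (convolution S (\<lambda>x. x) h)"
    if h: "h \<in> carrier H" for h
  proof -
    have t: "(\<lambda>a. \<epsilon> (a \<otimes>\<^bsub>H\<^esub> x)) \<in> module_hom K H (self_module K)"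
      and s: "(\<lambda>a. \<epsilon> (x \<otimes>\<^bsub>H\<^esub> a)) \<in> module_hom K H (self_module K)" if "x \<in> carrier H" for x
      by (rule module_hom_compose[OF counit_linear bilinear_left[OF bilinear_mult that]],
          rule module_hom_compose[OF counit_linear bilinear_right[OF bilinear_mult that]])
    have "convolution (\<lambda>x. x) S (f h)
      = tensor_lift H (\<lambda>a b. \<epsilon> (a \<otimes>\<^bsub>H\<^esub> f h) \<odot>\<^bsub>H\<^esub> b) (\<Delta> (f \<one>\<^bsub>H\<^esub>))"
      using h by (simp add: target_counital one)
    also have "\<dots> = tensor_lift H (\<lambda>a b. \<epsilon> (f a \<otimes>\<^bsub>H\<^esub> f h) \<odot>\<^bsub>H\<^esub> f b) (\<Delta> \<one>\<^bsub>H\<^esub>)"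
      using h by (intro lift_comult H_module bilinear_smult_compose t module_hom_ident) simp_all
    also have "\<dots> = tensor_lift H (\<lambda>a b. f (\<epsilon> (a \<otimes>\<^bsub>H\<^esub> h) \<odot>\<^bsub>H\<^esub> b)) (\<Delta> \<one>\<^bsub>H\<^esub>)"
      using h by (intro cong) (simp_all add: mult[symmetric] counit module_hom_smult[OF f])
    also have "\<dots> = f (convolution (\<lambda>x. x) S h)"
      unfolding target_counital[OF h]
      by (intro f_lift[symmetric] bilinear_smult_compose t h module_hom_ident) simp
    finally show "convolution (\<lambda>x. x) S (f h) = f (convolution (\<lambda>x. x) S h)" .
    have "convolution S (\<lambda>x. x) (f h)
      = tensor_lift H (\<lambda>a b. \<epsilon> (f h \<otimes>\<^bsub>H\<^esub> b) \<odot>\<^bsub>H\<^esub> a) (\<Delta> (f \<one>\<^bsub>H\<^esub>))"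
      using h by (simp add: source_counital one)
    also have "\<dots> = tensor_lift H (\<lambda>a b. \<epsilon> (f h \<otimes>\<^bsub>H\<^esub> f b) \<odot>\<^bsub>H\<^esub> f a) (\<Delta> \<one>\<^bsub>H\<^esub>)"
      using h by (intro lift_comult H_module bilinear_flip[OF bilinear_smult_compose] s
          module_hom_ident) simp_all
    also have "\<dots> = tensor_lift H (\<lambda>a b. f (\<epsilon> (h \<otimes>\<^bsub>H\<^esub> b) \<odot>\<^bsub>H\<^esub> a)) (\<Delta> \<one>\<^bsub>H\<^esub>)"
      using h by (intro cong) (simp_all add: mult[symmetric] counit module_hom_smult[OF f])
    also have "\<dots> = f (convolution S (\<lambda>x. x) h)"
      unfolding source_counital[OF h]
      by (intro f_lift[symmetric] bilinear_flip[OF bilinear_smult_compose] s h module_hom_ident) simp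
    finally show "convolution S (\<lambda>x. x) (f h) = f (convolution S (\<lambda>x. x) h)" .
  qed
  define T where "T h = S (f h)" for h
  define U where "U h = f (S h)" for h
  have T: "T \<in> module_hom K H H" and U: "U \<in> module_hom K H H"
    unfolding T_def[abs_def] U_def[abs_def]
    by (intro module_hom_compose[OF antipode_linear f] module_hom_compose[OF f antipode_linear])+
  have conv_f: "convolution \<phi> \<psi> (f h) = convolution (\<lambda>x. \<phi> (f x)) (\<lambda>x. \<psi> (f x)) h"
    if "\<phi> \<in> module_hom K H H" "\<psi> \<in> module_hom K H H" "h \<in> carrier H" for \<phi> \<psi> h
    unfolding convolution_def
    by (intro lift_comult H_module bilinear_mult_compose that)
  have f_conv: "f (convolution \<phi> \<psi> h) = convolution (\<lambda>x. f (\<phi> x)) (\<lambda>x. f (\<psi> x)) h"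
    if "\<phi> \<in> module_hom K H H" "\<psi> \<in> module_hom K H H" "h \<in> carrier H" for \<phi> \<psi> h
    unfolding convolution_def
    by (subst f_lift[OF bilinear_mult_compose[OF that(1,2)] that(3)])
      (intro cong that(3), simp add: mult module_hom_in[OF that(1)] module_hom_in[OF that(2)])
  note linear = antipode_linear module_hom_ident
  have fT: "convolution f T h = convolution f U h" if "h \<in> carrier H" for h
    unfolding T_def[abs_def] U_def[abs_def]
    using conv_f[OF module_hom_ident antipode_linear that] f_conv[OF module_hom_ident antipode_linear that]
      target[OF that] by simp
  have Tf: "convolution T f h = convolution U f h" if "h \<in> carrier H" for h
    unfolding T_def[abs_def] U_def[abs_def]
    using conv_f[OF antipode_linear module_hom_ident that] f_conv[OF antipode_linear module_hom_ident that]
      source[OF that] by simp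
  have TfT: "convolution (convolution T f) T h = T h" if h: "h \<in> carrier H" for h
  proof -
    have "T h = convolution (convolution S (\<lambda>x. x)) S (f h)"
      using h by (simp add: T_def antipode_convolution')
    also have "\<dots> = convolution (\<lambda>x. convolution S (\<lambda>x. x) (f x)) T h"
      unfolding T_def[abs_def] by (intro conv_f convolution_hom linear h)
    also have "\<dots> = convolution (convolution T f) T h"
      using h by (intro convolution_cong) (simp_all add: T_def[abs_def] conv_f linear)
    finally show ?thesis ..
  qed
  have UfU: "convolution (convolution U f) U h = U h" if h: "h \<in> carrier H" for h
  proof -
    have "U h = f (convolution (convolution S (\<lambda>x. x)) S h)"
      using h by (simp add: U_def antipode_convolution')
    also have "\<dots> = convolution (\<lambda>x. f (convolution S (\<lambda>x. x) x)) U h"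
      unfolding U_def[abs_def] by (intro f_conv convolution_hom linear h)
    also have "\<dots> = convolution (convolution U f) U h"
      using h by (intro convolution_cong) (simp_all add: U_def[abs_def] f_conv linear)
    finally show ?thesis ..
  qed
  have antipode: "S (f h) = f (S h)" if h: "h \<in> carrier H" for h
  proof -
    have "U h = convolution (convolution U f) U h" using UfU[OF h] ..
    also have "\<dots> = convolution (convolution T f) U h"
      using h by (rule convolution_cong[rotated 2]) (simp_all add: Tf)
    also have "\<dots> = convolution T (convolution f U) h"
      by (intro convolution_assoc T f U h)
    also have "\<dots> = convolution T (convolution f T) h"
      using h by (rule convolution_cong[rotated 2]) (simp_all add: fT)
    also have "\<dots> = convolution (convolution T f) T h"
      by (intro convolution_assoc[symmetric] T f h)
    finally show ?thesis using TfT[OF h] by (simp add: T_def U_def)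
  qed
  have "f \<in> ring_hom H H"
    by (intro ring_hom_memI) (simp_all add: mult one module_hom_add[OF f])
  then show ?thesis
    using f bij comult counit antipode by (simp add: weak_hopf_auto_def weak_hopf_hom_def)
qed

text \<open>
  Write \<open>G = g \<otimes> g\<close>. From \<open>\<Delta>(g) = \<Delta>(1) G\<close> it follows that \<open>\<Delta>(g\<^sup>-\<^sup>1) = \<Delta>(1) G\<^sup>-\<^sup>1\<close>. Together with
  \<open>\<Delta>(g) = G \<Delta>(1)\<close> this gives \<open>\<Delta>(g h g\<^sup>-\<^sup>1) = G \<Delta>(1) \<Delta>(h) \<Delta>(1) G\<^sup>-\<^sup>1 = G \<Delta>(h) G\<^sup>-\<^sup>1\<close>. The two copies
  of \<open>\<Delta>(1)\<close>, in general not the unit of \<open>H \<otimes> H\<close>, are absorbed because \<open>\<Delta>\<close> is multiplicative.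
\<close>

lemma group_like_conjugation:
  assumes "group_like K H g"
  shows "(\<lambda>h. g \<otimes>\<^bsub>H\<^esub> h \<otimes>\<^bsub>H\<^esub> inv\<^bsub>H\<^esub> g) \<in> weak_hopf_auto K H"
proof -
  let ?g' = "inv\<^bsub>H\<^esub> g" and ?f = "\<lambda>h. g \<otimes>\<^bsub>H\<^esub> h \<otimes>\<^bsub>H\<^esub> inv\<^bsub>H\<^esub> g"
  define G where "G = pure_tensor K H H g g"
  define G' where "G' = pure_tensor K H H ?g' ?g'"
  interpret HHm: Group.monoid HH by (rule monoid_HH)
  have unit: "g \<in> Units H" and left: "\<Delta> g = G \<otimes>\<^bsub>HH\<^esub> \<Delta> \<one>\<^bsub>H\<^esub>" and right: "\<Delta> g = \<Delta> \<one>\<^bsub>H\<^esub> \<otimes>\<^bsub>HH\<^esub> G"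
    using assms by (auto simp: group_like_def G_def)
  have g [simp]: "g \<in> carrier H" "?g' \<in> carrier H" using unit by auto
  have gg' [simp]: "g \<otimes>\<^bsub>H\<^esub> ?g' = \<one>\<^bsub>H\<^esub>" "?g' \<otimes>\<^bsub>H\<^esub> g = \<one>\<^bsub>H\<^esub>" using unit by auto
  have cancel [simp]: "?g' \<otimes>\<^bsub>H\<^esub> (g \<otimes>\<^bsub>H\<^esub> x) = x" "g \<otimes>\<^bsub>H\<^esub> (?g' \<otimes>\<^bsub>H\<^esub> x) = x" if "x \<in> carrier H" for x
    using that by (simp_all add: Alg.m_assoc[symmetric])
  have G [simp]: "G \<in> carrier HH" "G' \<in> carrier HH" by (simp_all add: G_def G'_def HH.pure_closed)
  have pure_pure: "pure_tensor K H H a b \<otimes>\<^bsub>HH\<^esub> pure_tensor K H H c d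
    = pure_tensor K H H (a \<otimes>\<^bsub>H\<^esub> c) (b \<otimes>\<^bsub>H\<^esub> d)"
    if "a \<in> carrier H" "b \<in> carrier H" "c \<in> carrier H" "d \<in> carrier H" for a b c d
    using that
    by (simp add: HH.pure_mult HH.pure_closed HH.lift_pure[OF HH.tensor_module
          HH.bilinear_times[OF HH.bilinear_pure]])
  have "pure_tensor K H H \<one>\<^bsub>H\<^esub> \<one>\<^bsub>H\<^esub> = \<one>\<^bsub>HH\<^esub>" by (simp add: tensor_def)
  then have GG' [simp]: "G \<otimes>\<^bsub>HH\<^esub> G' = \<one>\<^bsub>HH\<^esub>" "G' \<otimes>\<^bsub>HH\<^esub> G = \<one>\<^bsub>HH\<^esub>"
    by (simp_all add: G_def G'_def pure_pure)
  note [simp] = comult_closed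
  have \<Delta>1: "\<Delta> \<one>\<^bsub>H\<^esub> \<otimes>\<^bsub>HH\<^esub> \<Delta> h = \<Delta> h" "\<Delta> h \<otimes>\<^bsub>HH\<^esub> \<Delta> \<one>\<^bsub>H\<^esub> = \<Delta> h" if "h \<in> carrier H" for h
    using that by (simp_all add: comult_mult[symmetric])
  have inv: "\<Delta> ?g' = \<Delta> \<one>\<^bsub>H\<^esub> \<otimes>\<^bsub>HH\<^esub> G'"
  proof -
    have "\<Delta> \<one>\<^bsub>H\<^esub> = \<Delta> ?g' \<otimes>\<^bsub>HH\<^esub> \<Delta> g" by (simp add: comult_mult[symmetric])
    also have "\<dots> = (\<Delta> ?g' \<otimes>\<^bsub>HH\<^esub> \<Delta> \<one>\<^bsub>H\<^esub>) \<otimes>\<^bsub>HH\<^esub> G" by (simp add: right HHm.m_assoc)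
    also have "\<dots> = \<Delta> ?g' \<otimes>\<^bsub>HH\<^esub> G" by (simp add: \<Delta>1)
    finally show ?thesis by (simp add: HHm.m_assoc)
  qed
  have comult: "\<Delta> (?f h) = tensor_map K H H ?f ?f (\<Delta> h)" if h: "h \<in> carrier H" for h
  proof -
    have "\<Delta> (?f h) = G \<otimes>\<^bsub>HH\<^esub> \<Delta> \<one>\<^bsub>H\<^esub> \<otimes>\<^bsub>HH\<^esub> \<Delta> h \<otimes>\<^bsub>HH\<^esub> (\<Delta> \<one>\<^bsub>H\<^esub> \<otimes>\<^bsub>HH\<^esub> G')"
      using h by (simp add: comult_mult left inv)
    also have "\<dots> = G \<otimes>\<^bsub>HH\<^esub> (\<Delta> \<one>\<^bsub>H\<^esub> \<otimes>\<^bsub>HH\<^esub> \<Delta> h \<otimes>\<^bsub>HH\<^esub> \<Delta> \<one>\<^bsub>H\<^esub>) \<otimes>\<^bsub>HH\<^esub> G'"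
      using h by (simp add: HHm.m_assoc)
    also have "\<dots> = (G \<otimes>\<^bsub>HH\<^esub> \<Delta> h) \<otimes>\<^bsub>HH\<^esub> G'" using h by (simp add: \<Delta>1)
    also have "\<dots> = tensor_lift HH (\<lambda>a b. pure_tensor K H H (a \<otimes>\<^bsub>H\<^esub> ?g') (b \<otimes>\<^bsub>H\<^esub> ?g')) (G \<otimes>\<^bsub>HH\<^esub> \<Delta> h)"
      using h unfolding G'_def by (intro HH.mult_pure) simp_all
    also have "\<dots> = tensor_map K H H ?f ?f (\<Delta> h)"
    proof -
      have r: "(\<lambda>a. a \<otimes>\<^bsub>H\<^esub> ?g') \<in> module_hom K H H" by (intro bilinear_left[OF bilinear_mult] g)
      have b: "bilinear K H H HH (\<lambda>a b. pure_tensor K H H (a \<otimes>\<^bsub>H\<^esub> ?g') (b \<otimes>\<^bsub>H\<^esub> ?g'))"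
        by (rule bilinear_compose[OF HH.bilinear_pure r r])
      show ?thesis
        using h unfolding G_def tensor_map_def
        by (subst HH.lift_mult[OF HH.tensor_module b])
          (simp_all add: HH.pure_closed
            HH.lift_pure[OF HH.tensor_module HH.bilinear_lift_times[OF HH.tensor_module b]])
    qed
    finally show ?thesis .
  qed
  show ?thesis
  proof (rule weak_hopf_autoI)
    show "?f \<in> module_hom K H H"
      by (intro module_hom_compose[OF bilinear_left[OF bilinear_mult] bilinear_right[OF bilinear_mult]] g)
    show "bij_betw ?f (carrier H) (carrier H)"
      by (rule bij_betwI[where g = "\<lambda>h. ?g' \<otimes>\<^bsub>H\<^esub> h \<otimes>\<^bsub>H\<^esub> g"]) (simp_all add: Alg.m_assoc)
    show "?f (x \<otimes>\<^bsub>H\<^esub> y) = ?f x \<otimes>\<^bsub>H\<^esub> ?f y" if "x \<in> carrier H" "y \<in> carrier H" for x y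
      using that by (simp add: Alg.m_assoc)
  qed (rule comult)
qed

end

section \<open>The arrows of the dual\<close>

lemma dual_algebra_carrier:
  "\<phi> \<in> carrier (dual_algebra K H) \<longleftrightarrow>
    \<phi> \<in> module_hom K H (self_module K) \<and> \<phi> \<in> extensional (carrier H)"
  by (simp add: dual_algebra_def)

lemma dual_algebra_eqI:
  assumes "\<phi> \<in> carrier (dual_algebra K H)" "\<psi> \<in> carrier (dual_algebra K H)"
    "\<And>h. h \<in> carrier H \<Longrightarrow> \<phi> h = \<psi> h"
  shows "\<phi> = \<psi>"
  using assms by (intro extensionalityI[of _ "carrier H"]) (auto simp: dual_algebra_carrier)

lemma restrict_in_dual_algebra:
  assumes "module K H" "\<phi> \<in> module_hom K H (self_module K)"
  shows "restrict \<phi> (carrier H) \<in> carrier (dual_algebra K H)"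
  using module_hom_cong[OF _ assms, of "restrict \<phi> (carrier H)"] by (simp add: dual_algebra_carrier)

lemma dual_algebra_linear_simps:
  "add (dual_algebra K H) = (\<lambda>\<phi> \<psi>. restrict (\<lambda>h. \<phi> h \<oplus>\<^bsub>K\<^esub> \<psi> h) (carrier H))"
  "smult (dual_algebra K H) = (\<lambda>c \<phi>. restrict (\<lambda>h. c \<otimes>\<^bsub>K\<^esub> \<phi> h) (carrier H))"
  "zero (dual_algebra K H) = restrict (\<lambda>h. \<zero>\<^bsub>K\<^esub>) (carrier H)"
  by (simp_all add: dual_algebra_def)

lemma dual_algebra_module:
  fixes K :: "('k, 'r) ring_scheme" and H :: "('k, 'h, 'm) weak_hopf_scheme"
  assumes "module K H"
  shows "module K (dual_algebra K H)"
proof -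
  interpret H: module K H by fact
  let ?D = "dual_algebra K H"
  note carrier = dual_algebra_carrier[of _ K H]
  note restrict = restrict_in_dual_algebra[OF assms]
  note eqI = dual_algebra_eqI[where K = K and H = H]
  note ops = dual_algebra_linear_simps[of K H]
  have [simp]: "\<phi> h \<in> carrier K" if "\<phi> \<in> carrier ?D" "h \<in> carrier H" for \<phi> h
    using that module_hom_in[of \<phi> K H "self_module K" h] by (simp add: carrier)
  note K = self_module_module[OF H.R.is_cring]
  have add: "\<phi> \<oplus>\<^bsub>?D\<^esub> \<psi> \<in> carrier ?D" if "\<phi> \<in> carrier ?D" "\<psi> \<in> carrier ?D" for \<phi> \<psi>
    using restrict[OF module_hom_plus[OF K, of \<phi> H \<psi>]] that by (simp add: ops carrier)
  have smult: "c \<odot>\<^bsub>?D\<^esub> \<phi> \<in> carrier ?D" if "c \<in> carrier K" "\<phi> \<in> carrier ?D" for c \<phi>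
    using restrict[OF module_hom_scale[OF K, of c \<phi> H]] that by (simp add: ops carrier)
  have zero: "\<zero>\<^bsub>?D\<^esub> \<in> carrier ?D"
    using restrict[OF module_hom_const_zero[OF K]] by (simp add: ops)
  have "abelian_group ?D"
  proof (rule abelian_groupI)
    fix \<phi> assume \<phi>: "\<phi> \<in> carrier ?D"
    have "(\<ominus>\<^bsub>K\<^esub> \<one>\<^bsub>K\<^esub>) \<odot>\<^bsub>?D\<^esub> \<phi> \<oplus>\<^bsub>?D\<^esub> \<phi> = \<zero>\<^bsub>?D\<^esub>"
      using \<phi> by (intro eqI add smult zero) (simp_all add: ops H.R.l_minus H.R.l_neg)
    then show "\<exists>\<psi>\<in>carrier ?D. \<psi> \<oplus>\<^bsub>?D\<^esub> \<phi> = \<zero>\<^bsub>?D\<^esub>" using smult[OF _ \<phi>] by blast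
  qed (intro eqI add zero; simp add: ops H.R.a_ac)+
  then show ?thesis
    by (intro moduleI H.R.is_cring smult; (intro eqI add smult)?)
      (simp_all add: ops H.R.l_distr H.R.r_distr H.R.m_assoc)
qed

context weak_hopf_algebra
begin

abbreviation "functional \<phi> \<equiv> \<phi> \<in> module_hom K H (self_module K)"
abbreviation "D \<equiv> dual_algebra K H"
abbreviation "L \<phi> h \<equiv> arrow_left H \<phi> h"
abbreviation "R \<phi> h \<equiv> arrow_right H h \<phi>"

lemma functional_closed: "functional \<phi> \<Longrightarrow> h \<in> carrier H \<Longrightarrow> \<phi> h \<in> carrier K"
  using module_hom_in[of \<phi> K H "self_module K" h] by simp

lemma functional_smult:
  "functional \<phi> \<Longrightarrow> c \<in> carrier K \<Longrightarrow> h \<in> carrier H \<Longrightarrow> \<phi> (c \<odot>\<^bsub>H\<^esub> h) = c \<otimes>\<^bsub>K\<^esub> \<phi> h"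
  using module_hom_smult[of \<phi> K H "self_module K" c h] by simp

lemmas dual_eqI = dual_algebra_eqI[where K = K and H = H]

lemma arrow_bilinear:
  assumes "functional \<phi>"
  shows "bilinear K H H H (\<lambda>a b. \<phi> b \<odot>\<^bsub>H\<^esub> a)" "bilinear K H H H (\<lambda>a b. \<phi> a \<odot>\<^bsub>H\<^esub> b)"
  by (rule bilinear_flip[OF bilinear_smult_compose[OF assms module_hom_ident]],
      rule bilinear_smult_compose[OF assms module_hom_ident])

lemma L_hom: "functional \<phi> \<Longrightarrow> L \<phi> \<in> module_hom K H H"
  unfolding arrow_left_def by (intro sweedler_hom H_module arrow_bilinear)

lemma R_hom: "functional \<phi> \<Longrightarrow> R \<phi> \<in> module_hom K H H"
  unfolding arrow_right_def by (intro sweedler_hom H_module arrow_bilinear)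

lemma L_closed: "functional \<phi> \<Longrightarrow> h \<in> carrier H \<Longrightarrow> L \<phi> h \<in> carrier H"
  by (rule module_hom_in[OF L_hom])

lemma R_closed: "functional \<phi> \<Longrightarrow> h \<in> carrier H \<Longrightarrow> R \<phi> h \<in> carrier H"
  by (rule module_hom_in[OF R_hom])

text \<open>
  Evaluating a convolution product is evaluating one factor after the arrow of the other. These two
  formulas transfer every statement about products in the dual to the maps \<open>L\<close> and \<open>R\<close>.
\<close>

lemma
  assumes \<phi>: "functional \<phi>" and \<psi>: "functional \<psi>" and h: "h \<in> carrier H"
  shows dual_mult_R: "(\<phi> \<otimes>\<^bsub>D\<^esub> \<psi>) h = \<psi> (R \<phi> h)" and dual_mult_L: "(\<phi> \<otimes>\<^bsub>D\<^esub> \<psi>) h = \<phi> (L \<psi> h)"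
proof -
  have *: "(\<phi> \<otimes>\<^bsub>D\<^esub> \<psi>) h = tensor_lift K (\<lambda>a b. \<phi> a \<otimes>\<^bsub>K\<^esub> \<psi> b) (\<Delta> h)"
    using h by (simp add: dual_algebra_def)
  also have "\<dots> = tensor_lift K (\<lambda>a b. \<psi> (\<phi> a \<odot>\<^bsub>H\<^esub> b)) (\<Delta> h)"
    by (intro HH.lift_cong comult_closed h)
      (simp add: functional_closed[OF \<phi>] functional_smult[OF \<psi>])
  also have "\<dots> = \<psi> (R \<phi> h)"
    unfolding arrow_right_def
    using HH.hom_lift[OF H_module module_K \<psi> arrow_bilinear(2)[OF \<phi>] comult_closed[OF h]] by simp
  finally show "(\<phi> \<otimes>\<^bsub>D\<^esub> \<psi>) h = \<psi> (R \<phi> h)" .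
  note *
  also have "tensor_lift K (\<lambda>a b. \<phi> a \<otimes>\<^bsub>K\<^esub> \<psi> b) (\<Delta> h) = tensor_lift K (\<lambda>a b. \<phi> (\<psi> b \<odot>\<^bsub>H\<^esub> a)) (\<Delta> h)"
    by (intro HH.lift_cong comult_closed h)
      (simp add: functional_closed[OF \<phi>] functional_closed[OF \<psi>] functional_smult[OF \<phi>] K_commute)
  also have "\<dots> = \<phi> (L \<psi> h)"
    unfolding arrow_left_def
    using HH.hom_lift[OF H_module module_K \<phi> arrow_bilinear(1)[OF \<psi>] comult_closed[OF h]] by simp
  finally show "(\<phi> \<otimes>\<^bsub>D\<^esub> \<psi>) h = \<phi> (L \<psi> h)" .
qed

text \<open>
  All three are coassociativity: \<open>L\<close> acts on the last and \<open>R\<close> on the first tensor factor, and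
  \<open>h\<^sub>(\<^sub>1\<^sub>) \<phi>(h\<^sub>(\<^sub>2\<^sub>)) \<otimes> h\<^sub>(\<^sub>3\<^sub>)\<close> can be read as an arrow on either factor.
\<close>

lemma
  assumes \<phi>: "functional \<phi>" and h: "h \<in> carrier H"
  shows comult_L: "\<Delta> (L \<phi> h) = tensor_map K H H (\<lambda>x. x) (L \<phi>) (\<Delta> h)"
    and comult_R: "\<Delta> (R \<phi> h) = tensor_map K H H (R \<phi>) (\<lambda>x. x) (\<Delta> h)"
    and L_R_middle: "tensor_map K H H (L \<phi>) (\<lambda>x. x) (\<Delta> h) = tensor_map K H H (\<lambda>x. x) (R \<phi>) (\<Delta> h)"
proof -
  note HHm = HH.tensor_module
  note pl = bilinear_left[OF HH.bilinear_pure] and pr = bilinear_right[OF HH.bilinear_pure]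
  note closed = functional_closed[OF \<phi>] HH.pure_closed comult_closed
  note scale = module_hom_scale[OF HHm] module_hom_scale_vector[OF HHm _ \<phi>]
  have "\<Delta> (L \<phi> h) = tensor_lift HH (\<lambda>a b. \<Delta> (\<phi> b \<odot>\<^bsub>H\<^esub> a)) (\<Delta> h)"
    unfolding arrow_left_def
    by (rule HH.hom_lift[OF H_module HHm comult_linear arrow_bilinear(1)[OF \<phi>] comult_closed[OF h]])
  also have "\<dots> = tensor_lift HH (\<lambda>x c. tensor_lift HH (\<lambda>a b. \<phi> c \<odot>\<^bsub>HH\<^esub> pure_tensor K H H a b) (\<Delta> x)) (\<Delta> h)"
    using HH.hom_lift[OF HHm HHm module_hom_scale[OF HHm _ module_hom_ident] HH.bilinear_pure]
    by (intro HH.lift_cong comult_closed h)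
      (simp add: module_hom_smult[OF comult_linear] closed HH.lift_pure_tensor)
  also have "\<dots> = tensor_lift HH (\<lambda>a x. tensor_lift HH (\<lambda>b c. \<phi> c \<odot>\<^bsub>HH\<^esub> pure_tensor K H H a b) (\<Delta> x)) (\<Delta> h)"
    by (intro coassoc_lift HHm h scale pl pr closed)
  also have "\<dots> = tensor_map K H H (\<lambda>x. x) (L \<phi>) (\<Delta> h)"
    unfolding tensor_map_def arrow_left_def
    by (intro HH.lift_cong comult_closed h)
      (simp add: HH.hom_lift[OF H_module HHm pr arrow_bilinear(1)[OF \<phi>]] closed
        HH.pure_smult_right cong: HH.lift_cong)
  finally show "\<Delta> (L \<phi> h) = tensor_map K H H (\<lambda>x. x) (L \<phi>) (\<Delta> h)" .
  have "\<Delta> (R \<phi> h) = tensor_lift HH (\<lambda>a b. \<Delta> (\<phi> a \<odot>\<^bsub>H\<^esub> b)) (\<Delta> h)"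
    unfolding arrow_right_def
    by (rule HH.hom_lift[OF H_module HHm comult_linear arrow_bilinear(2)[OF \<phi>] comult_closed[OF h]])
  also have "\<dots> = tensor_lift HH (\<lambda>a x. tensor_lift HH (\<lambda>b c. \<phi> a \<odot>\<^bsub>HH\<^esub> pure_tensor K H H b c) (\<Delta> x)) (\<Delta> h)"
    using HH.hom_lift[OF HHm HHm module_hom_scale[OF HHm _ module_hom_ident] HH.bilinear_pure]
    by (intro HH.lift_cong comult_closed h)
      (simp add: module_hom_smult[OF comult_linear] closed HH.lift_pure_tensor)
  also have "\<dots> = tensor_lift HH (\<lambda>x c. tensor_lift HH (\<lambda>a b. \<phi> a \<odot>\<^bsub>HH\<^esub> pure_tensor K H H b c) (\<Delta> x)) (\<Delta> h)"
    by (intro coassoc_lift[symmetric] HHm h scale pl pr closed)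
  also have "\<dots> = tensor_map K H H (R \<phi>) (\<lambda>x. x) (\<Delta> h)"
    unfolding tensor_map_def arrow_right_def
    by (intro HH.lift_cong comult_closed h)
      (simp add: HH.hom_lift[OF H_module HHm pl arrow_bilinear(2)[OF \<phi>]] closed
        HH.pure_smult_left cong: HH.lift_cong)
  finally show "\<Delta> (R \<phi> h) = tensor_map K H H (R \<phi>) (\<lambda>x. x) (\<Delta> h)" .
  have "tensor_map K H H (L \<phi>) (\<lambda>x. x) (\<Delta> h)
    = tensor_lift HH (\<lambda>x c. tensor_lift HH (\<lambda>a b. \<phi> b \<odot>\<^bsub>HH\<^esub> pure_tensor K H H a c) (\<Delta> x)) (\<Delta> h)"
    unfolding tensor_map_def arrow_left_def
    by (intro HH.lift_cong comult_closed h)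
      (simp add: HH.hom_lift[OF H_module HHm pl arrow_bilinear(1)[OF \<phi>]] closed
        HH.pure_smult_left cong: HH.lift_cong)
  also have "\<dots> = tensor_lift HH (\<lambda>a x. tensor_lift HH (\<lambda>b c. \<phi> b \<odot>\<^bsub>HH\<^esub> pure_tensor K H H a c) (\<Delta> x)) (\<Delta> h)"
    by (intro coassoc_lift HHm h scale pl pr closed)
  also have "\<dots> = tensor_map K H H (\<lambda>x. x) (R \<phi>) (\<Delta> h)"
    unfolding tensor_map_def arrow_right_def
    by (intro HH.lift_cong comult_closed h)
      (simp add: HH.hom_lift[OF H_module HHm pr arrow_bilinear(2)[OF \<phi>]] closed
        HH.pure_smult_right cong: HH.lift_cong)
  finally show "tensor_map K H H (L \<phi>) (\<lambda>x. x) (\<Delta> h) = tensor_map K H H (\<lambda>x. x) (R \<phi>) (\<Delta> h)" .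
qed

lemma
  assumes \<phi>: "functional \<phi>" and P: "module K P" "bilinear K H H P \<beta>" and h: "h \<in> carrier H"
  shows lift_comult_L: "tensor_lift P \<beta> (\<Delta> (L \<phi> h)) = tensor_lift P (\<lambda>a b. \<beta> a (L \<phi> b)) (\<Delta> h)"
    and lift_comult_R: "tensor_lift P \<beta> (\<Delta> (R \<phi> h)) = tensor_lift P (\<lambda>a b. \<beta> (R \<phi> a) b) (\<Delta> h)"
    and lift_L_R_middle: "tensor_lift P (\<lambda>a b. \<beta> (L \<phi> a) b) (\<Delta> h) = tensor_lift P (\<lambda>a b. \<beta> a (R \<phi> b)) (\<Delta> h)"
proof -
  note * = HH.lift_tensor_map[OF two_modules_H_H _ _ comult_closed[OF h] P]
  show "tensor_lift P \<beta> (\<Delta> (L \<phi> h)) = tensor_lift P (\<lambda>a b. \<beta> a (L \<phi> b)) (\<Delta> h)"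
    unfolding comult_L[OF \<phi> h] by (rule *[OF module_hom_ident L_hom[OF \<phi>]])
  show "tensor_lift P \<beta> (\<Delta> (R \<phi> h)) = tensor_lift P (\<lambda>a b. \<beta> (R \<phi> a) b) (\<Delta> h)"
    unfolding comult_R[OF \<phi> h] by (rule *[OF R_hom[OF \<phi>] module_hom_ident])
  show "tensor_lift P (\<lambda>a b. \<beta> (L \<phi> a) b) (\<Delta> h) = tensor_lift P (\<lambda>a b. \<beta> a (R \<phi> b)) (\<Delta> h)"
    using *[OF L_hom[OF \<phi>] module_hom_ident] *[OF module_hom_ident R_hom[OF \<phi>]] L_R_middle[OF \<phi> h]
    by simp
qed

lemma
  assumes \<phi>: "functional \<phi>" and \<psi>: "functional \<psi>" and h: "h \<in> carrier H"
  shows L_L: "L \<phi> (L \<psi> h) = L (\<phi> \<otimes>\<^bsub>D\<^esub> \<psi>) h"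
    and R_R: "R \<psi> (R \<phi> h) = R (\<phi> \<otimes>\<^bsub>D\<^esub> \<psi>) h"
    and L_R: "L \<phi> (R \<psi> h) = R \<psi> (L \<phi> h)"
proof -
  have "L \<phi> (L \<psi> h) = tensor_lift H (\<lambda>a b. \<phi> (L \<psi> b) \<odot>\<^bsub>H\<^esub> a) (\<Delta> h)"
    unfolding arrow_left_def[of H \<phi>] by (rule lift_comult_L[OF \<psi> H_module arrow_bilinear(1)[OF \<phi>] h])
  also have "\<dots> = L (\<phi> \<otimes>\<^bsub>D\<^esub> \<psi>) h"
    unfolding arrow_left_def[of H "\<phi> \<otimes>\<^bsub>D\<^esub> \<psi>"]
    by (intro HH.lift_cong comult_closed h) (simp add: dual_mult_L[OF \<phi> \<psi>])
  finally show "L \<phi> (L \<psi> h) = L (\<phi> \<otimes>\<^bsub>D\<^esub> \<psi>) h" .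
  have "R \<psi> (R \<phi> h) = tensor_lift H (\<lambda>a b. \<psi> (R \<phi> a) \<odot>\<^bsub>H\<^esub> b) (\<Delta> h)"
    unfolding arrow_right_def[of H _ \<psi>] by (rule lift_comult_R[OF \<phi> H_module arrow_bilinear(2)[OF \<psi>] h])
  also have "\<dots> = R (\<phi> \<otimes>\<^bsub>D\<^esub> \<psi>) h"
    unfolding arrow_right_def[of H _ "\<phi> \<otimes>\<^bsub>D\<^esub> \<psi>"]
    by (intro HH.lift_cong comult_closed h) (simp add: dual_mult_R[OF \<phi> \<psi>])
  finally show "R \<psi> (R \<phi> h) = R (\<phi> \<otimes>\<^bsub>D\<^esub> \<psi>) h" .
  have "L \<phi> (R \<psi> h) = tensor_lift H (\<lambda>a b. \<phi> b \<odot>\<^bsub>H\<^esub> R \<psi> a) (\<Delta> h)"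
    unfolding arrow_left_def[of H \<phi>] by (rule lift_comult_R[OF \<psi> H_module arrow_bilinear(1)[OF \<phi>] h])
  also have "\<dots> = tensor_lift H (\<lambda>a b. R \<psi> (\<phi> b \<odot>\<^bsub>H\<^esub> a)) (\<Delta> h)"
    by (intro HH.lift_cong comult_closed h)
      (simp add: module_hom_smult[OF R_hom[OF \<psi>]] functional_closed[OF \<phi>])
  also have "\<dots> = R \<psi> (L \<phi> h)"
    unfolding arrow_left_def[of H \<phi>]
    by (rule HH.hom_lift[symmetric, OF H_module H_module R_hom[OF \<psi>] arrow_bilinear(1)[OF \<phi>]
          comult_closed[OF h]])
  finally show "L \<phi> (R \<psi> h) = R \<psi> (L \<phi> h)" .
qed

lemma dual_one: "\<one>\<^bsub>D\<^esub> = restrict \<epsilon> (carrier H)"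
  by (simp add: dual_algebra_def)

lemma dual_one_closed: "\<one>\<^bsub>D\<^esub> \<in> carrier D"
  unfolding dual_one by (rule restrict_in_dual_algebra[OF H_module counit_linear])

lemma
  assumes h: "h \<in> carrier H"
  shows L_one: "L \<one>\<^bsub>D\<^esub> h = h" and R_one: "R \<one>\<^bsub>D\<^esub> h = h"
proof -
  have "L \<one>\<^bsub>D\<^esub> h = tensor_lift H (\<lambda>a b. \<epsilon> b \<odot>\<^bsub>H\<^esub> a) (\<Delta> h)"
    unfolding arrow_left_def by (intro HH.lift_cong comult_closed h) (simp add: dual_one)
  then show "L \<one>\<^bsub>D\<^esub> h = h" using counit_right[OF h] by simp
  have "R \<one>\<^bsub>D\<^esub> h = tensor_lift H (\<lambda>a b. \<epsilon> a \<odot>\<^bsub>H\<^esub> b) (\<Delta> h)"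
    unfolding arrow_right_def by (intro HH.lift_cong comult_closed h) (simp add: dual_one)
  then show "R \<one>\<^bsub>D\<^esub> h = h" using counit_left[OF h] by simp
qed

lemma dual_mult_closed:
  assumes "functional \<phi>" "functional \<psi>"
  shows "\<phi> \<otimes>\<^bsub>D\<^esub> \<psi> \<in> carrier D"
proof -
  have "functional (\<lambda>h. \<psi> (R \<phi> h))" by (rule module_hom_compose[OF assms(2) R_hom[OF assms(1)]])
  then have "functional (\<phi> \<otimes>\<^bsub>D\<^esub> \<psi>)"
    by (rule module_hom_cong[rotated 2]) (simp_all add: dual_mult_R assms H_module)
  then show ?thesis by (simp add: dual_algebra_carrier) (simp add: dual_algebra_def)
qed

lemma functionalI: "\<phi> \<in> carrier D \<Longrightarrow> functional \<phi>"
  by (simp add: dual_algebra_carrier)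

lemma dual_monoid: "Group.monoid D"
proof (rule monoidI)
  fix \<phi> \<psi> \<chi> assume "\<phi> \<in> carrier D" "\<psi> \<in> carrier D" "\<chi> \<in> carrier D"
  then have *: "functional \<phi>" "functional \<psi>" "functional \<chi>" and \<phi>: "\<phi> \<in> carrier D"
    by (simp_all add: functionalI)
  note [simp] = functionalI[OF dual_mult_closed] functionalI[OF dual_one_closed]
    dual_mult_closed dual_one_closed L_closed R_closed
  show "\<phi> \<otimes>\<^bsub>D\<^esub> \<psi> \<in> carrier D" using * by simp
  show "\<phi> \<otimes>\<^bsub>D\<^esub> \<psi> \<otimes>\<^bsub>D\<^esub> \<chi> = \<phi> \<otimes>\<^bsub>D\<^esub> (\<psi> \<otimes>\<^bsub>D\<^esub> \<chi>)"
    using * by (intro dual_eqI) (simp_all add: dual_mult_L[where \<psi> = \<chi>] dual_mult_R[where \<phi> = \<phi>] L_R)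
  show "\<one>\<^bsub>D\<^esub> \<otimes>\<^bsub>D\<^esub> \<phi> = \<phi>"
    using * \<phi> by (intro dual_eqI) (simp_all add: dual_mult_R R_one)
  show "\<phi> \<otimes>\<^bsub>D\<^esub> \<one>\<^bsub>D\<^esub> = \<phi>"
    using * \<phi> by (intro dual_eqI) (simp_all add: dual_mult_L L_one)
qed (rule dual_one_closed)

text \<open>
  The hypothesis is one half of group-likeness of \<open>\<gamma>\<close>, in the form that \<open>\<Delta>(\<gamma>) = \<Delta>(\<epsilon>)(\<gamma> \<otimes> \<gamma>)\<close> takes after
  evaluation at \<open>h \<otimes> g\<close>. Write \<open>L\<close> for \<open>L \<gamma>\<close>. Since \<open>L\<close> acts on the last factor,
  \<open>h\<^sub>(\<^sub>1\<^sub>) g\<^sub>(\<^sub>1\<^sub>) \<epsilon>(L(h\<^sub>(\<^sub>2\<^sub>)) L(g\<^sub>(\<^sub>2\<^sub>)))\<close> is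
  \<open>(L h)\<^sub>(\<^sub>1\<^sub>) (L g)\<^sub>(\<^sub>1\<^sub>) \<epsilon>((L h)\<^sub>(\<^sub>2\<^sub>) (L g)\<^sub>(\<^sub>2\<^sub>))\<close>, which the counit reduces to the product of \<open>L h\<close> and \<open>L g\<close>.
\<close>

lemma L_mult:
  assumes \<gamma>: "functional \<gamma>"
    and \<gamma>_mult: "\<And>h g. h \<in> carrier H \<Longrightarrow> g \<in> carrier H \<Longrightarrow> \<gamma> (h \<otimes>\<^bsub>H\<^esub> g) = \<epsilon> (L \<gamma> h \<otimes>\<^bsub>H\<^esub> L \<gamma> g)"
    and h: "h \<in> carrier H" and g: "g \<in> carrier H"
  shows "L \<gamma> (h \<otimes>\<^bsub>H\<^esub> g) = L \<gamma> h \<otimes>\<^bsub>H\<^esub> L \<gamma> g"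
proof -
  note \<epsilon> = arrow_bilinear(1)[OF counit_linear]
  have "L \<gamma> h \<otimes>\<^bsub>H\<^esub> L \<gamma> g = tensor_lift H (\<lambda>a b. \<epsilon> b \<odot>\<^bsub>H\<^esub> a) (\<Delta> (L \<gamma> h) \<otimes>\<^bsub>HH\<^esub> \<Delta> (L \<gamma> g))"
    using L_closed[OF \<gamma>] h g by (simp add: comult_mult[symmetric] counit_right)
  also have "\<dots> = tensor_lift H (\<lambda>a b. tensor_lift H
    (\<lambda>a' b'. \<epsilon> (b \<otimes>\<^bsub>H\<^esub> b') \<odot>\<^bsub>H\<^esub> (a \<otimes>\<^bsub>H\<^esub> a')) (\<Delta> (L \<gamma> g))) (\<Delta> (L \<gamma> h))"
    by (intro HH.lift_mult H_module \<epsilon> comult_closed L_closed \<gamma> h g)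
  also have "\<dots> = tensor_lift H (\<lambda>a b. tensor_lift H
    (\<lambda>a' b'. \<epsilon> (L \<gamma> b \<otimes>\<^bsub>H\<^esub> b') \<odot>\<^bsub>H\<^esub> (a \<otimes>\<^bsub>H\<^esub> a')) (\<Delta> (L \<gamma> g))) (\<Delta> h)"
    by (intro lift_comult_L[OF \<gamma> H_module] HH.bilinear_lift_times H_module \<epsilon> comult_closed L_closed \<gamma> h g)
  also have "\<dots> = tensor_lift H (\<lambda>a b. tensor_lift H
    (\<lambda>a' b'. \<epsilon> (L \<gamma> b \<otimes>\<^bsub>H\<^esub> L \<gamma> b') \<odot>\<^bsub>H\<^esub> (a \<otimes>\<^bsub>H\<^esub> a')) (\<Delta> g)) (\<Delta> h)"
    by (intro HH.lift_cong comult_closed h lift_comult_L[OF \<gamma> H_module] HH.bilinear_times \<epsilon> L_closed \<gamma> g)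
  also have "\<dots> = tensor_lift H (\<lambda>a b. tensor_lift H
    (\<lambda>a' b'. \<gamma> (b \<otimes>\<^bsub>H\<^esub> b') \<odot>\<^bsub>H\<^esub> (a \<otimes>\<^bsub>H\<^esub> a')) (\<Delta> g)) (\<Delta> h)"
    by (intro HH.lift_cong comult_closed h g) (simp add: \<gamma>_mult)
  also have "\<dots> = tensor_lift H (\<lambda>a b. \<gamma> b \<odot>\<^bsub>H\<^esub> a) (\<Delta> h \<otimes>\<^bsub>HH\<^esub> \<Delta> g)"
    by (intro HH.lift_mult[symmetric] H_module arrow_bilinear \<gamma> comult_closed h g)
  also have "\<dots> = L \<gamma> (h \<otimes>\<^bsub>H\<^esub> g)"
    using h g by (simp add: arrow_left_def comult_mult)
  finally show ?thesis ..
qed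

text \<open>
  The mirror image, with the other half \<open>\<Delta>(\<gamma>) = (\<gamma> \<otimes> \<gamma>)\<Delta>(\<epsilon>)\<close> of group-likeness.
\<close>

lemma R_mult:
  assumes \<gamma>: "functional \<gamma>"
    and \<gamma>_mult: "\<And>h g. h \<in> carrier H \<Longrightarrow> g \<in> carrier H \<Longrightarrow> \<gamma> (h \<otimes>\<^bsub>H\<^esub> g) = \<epsilon> (R \<gamma> h \<otimes>\<^bsub>H\<^esub> R \<gamma> g)"
    and h: "h \<in> carrier H" and g: "g \<in> carrier H"
  shows "R \<gamma> (h \<otimes>\<^bsub>H\<^esub> g) = R \<gamma> h \<otimes>\<^bsub>H\<^esub> R \<gamma> g"
proof -
  note \<epsilon> = arrow_bilinear(2)[OF counit_linear]
  have "R \<gamma> h \<otimes>\<^bsub>H\<^esub> R \<gamma> g = tensor_lift H (\<lambda>a b. \<epsilon> a \<odot>\<^bsub>H\<^esub> b) (\<Delta> (R \<gamma> h) \<otimes>\<^bsub>HH\<^esub> \<Delta> (R \<gamma> g))"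
    using R_closed[OF \<gamma>] h g by (simp add: comult_mult[symmetric] counit_left)
  also have "\<dots> = tensor_lift H (\<lambda>a b. tensor_lift H
    (\<lambda>a' b'. \<epsilon> (a \<otimes>\<^bsub>H\<^esub> a') \<odot>\<^bsub>H\<^esub> (b \<otimes>\<^bsub>H\<^esub> b')) (\<Delta> (R \<gamma> g))) (\<Delta> (R \<gamma> h))"
    by (intro HH.lift_mult H_module \<epsilon> comult_closed R_closed \<gamma> h g)
  also have "\<dots> = tensor_lift H (\<lambda>a b. tensor_lift H
    (\<lambda>a' b'. \<epsilon> (R \<gamma> a \<otimes>\<^bsub>H\<^esub> a') \<odot>\<^bsub>H\<^esub> (b \<otimes>\<^bsub>H\<^esub> b')) (\<Delta> (R \<gamma> g))) (\<Delta> h)"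
    by (intro lift_comult_R[OF \<gamma> H_module] HH.bilinear_lift_times H_module \<epsilon> comult_closed R_closed \<gamma> h g)
  also have "\<dots> = tensor_lift H (\<lambda>a b. tensor_lift H
    (\<lambda>a' b'. \<epsilon> (R \<gamma> a \<otimes>\<^bsub>H\<^esub> R \<gamma> a') \<odot>\<^bsub>H\<^esub> (b \<otimes>\<^bsub>H\<^esub> b')) (\<Delta> g)) (\<Delta> h)"
    by (intro HH.lift_cong comult_closed h lift_comult_R[OF \<gamma> H_module] HH.bilinear_times \<epsilon> R_closed \<gamma> g)
  also have "\<dots> = tensor_lift H (\<lambda>a b. tensor_lift H
    (\<lambda>a' b'. \<gamma> (a \<otimes>\<^bsub>H\<^esub> a') \<odot>\<^bsub>H\<^esub> (b \<otimes>\<^bsub>H\<^esub> b')) (\<Delta> g)) (\<Delta> h)"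
    by (intro HH.lift_cong comult_closed h g) (simp add: \<gamma>_mult)
  also have "\<dots> = tensor_lift H (\<lambda>a b. \<gamma> a \<odot>\<^bsub>H\<^esub> b) (\<Delta> h \<otimes>\<^bsub>HH\<^esub> \<Delta> g)"
    by (intro HH.lift_mult[symmetric] H_module arrow_bilinear \<gamma> comult_closed h g)
  also have "\<dots> = R \<gamma> (h \<otimes>\<^bsub>H\<^esub> g)"
    using h g by (simp add: arrow_right_def comult_mult)
  finally show ?thesis ..
qed

text \<open>
  With \<open>\<gamma>' = \<gamma>\<^sup>-\<^sup>1\<close>, the maps \<open>L \<gamma>\<close> and \<open>R \<gamma>\<close> are bijections with inverses \<open>L \<gamma>'\<close> and \<open>R \<gamma>'\<close>. Both are
  multiplicative, hence so is the inverse \<open>R \<gamma>'\<close>, and hence the composite \<open>f = R \<gamma>' \<circ> L \<gamma>\<close>.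

  The two factors need not be coalgebra maps, but the composite is:
  \<open>\<Delta>(f(h)) = R \<gamma>'(h\<^sub>(\<^sub>1\<^sub>)) \<otimes> L \<gamma>(h\<^sub>(\<^sub>2\<^sub>))\<close>, and this is \<open>f(h\<^sub>(\<^sub>1\<^sub>)) \<otimes> f(h\<^sub>(\<^sub>2\<^sub>))\<close> because the inner arrows
  \<open>L \<gamma>\<close> and \<open>R \<gamma>'\<close> meet in the middle of the Sweedler sum and cancel.
\<close>

lemma dual_conjugation:
  assumes \<gamma>: "functional \<gamma>" and \<gamma>': "functional \<gamma>'"
    and inv: "\<gamma> \<otimes>\<^bsub>D\<^esub> \<gamma>' = \<one>\<^bsub>D\<^esub>" "\<gamma>' \<otimes>\<^bsub>D\<^esub> \<gamma> = \<one>\<^bsub>D\<^esub>"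
    and \<gamma>_L: "\<And>h g. h \<in> carrier H \<Longrightarrow> g \<in> carrier H \<Longrightarrow> \<gamma> (h \<otimes>\<^bsub>H\<^esub> g) = \<epsilon> (L \<gamma> h \<otimes>\<^bsub>H\<^esub> L \<gamma> g)"
    and \<gamma>_R: "\<And>h g. h \<in> carrier H \<Longrightarrow> g \<in> carrier H \<Longrightarrow> \<gamma> (h \<otimes>\<^bsub>H\<^esub> g) = \<epsilon> (R \<gamma> h \<otimes>\<^bsub>H\<^esub> R \<gamma> g)"
  shows "(\<lambda>h. R \<gamma>' (L \<gamma> h)) \<in> weak_hopf_auto K H"
proof (rule weak_hopf_autoI)
  let ?f = "\<lambda>h. R \<gamma>' (L \<gamma> h)"
  note hom = L_hom[OF \<gamma>] L_hom[OF \<gamma>'] R_hom[OF \<gamma>] R_hom[OF \<gamma>']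
  note [simp] = L_closed[OF \<gamma>] L_closed[OF \<gamma>'] R_closed[OF \<gamma>] R_closed[OF \<gamma>']
  have [simp]: "L \<gamma> (L \<gamma>' h) = h" "L \<gamma>' (L \<gamma> h) = h" "R \<gamma> (R \<gamma>' h) = h" "R \<gamma>' (R \<gamma> h) = h"
    if "h \<in> carrier H" for h
    using that by (simp_all add: L_L R_R \<gamma> \<gamma>' inv L_one R_one)
  show f: "?f \<in> module_hom K H H" by (intro module_hom_compose[OF hom(4) hom(1)])
  show "bij_betw ?f (carrier H) (carrier H)"
    by (rule bij_betwI[where g = "\<lambda>h. L \<gamma>' (R \<gamma> h)"]) simp_all
  have R'_mult: "R \<gamma>' (x \<otimes>\<^bsub>H\<^esub> y) = R \<gamma>' x \<otimes>\<^bsub>H\<^esub> R \<gamma>' y" if "x \<in> carrier H" "y \<in> carrier H" for x y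
  proof -
    have "R \<gamma>' (x \<otimes>\<^bsub>H\<^esub> y) = R \<gamma>' (R \<gamma> (R \<gamma>' x \<otimes>\<^bsub>H\<^esub> R \<gamma>' y))"
      using that R_mult[OF \<gamma> \<gamma>_R, of "R \<gamma>' x" "R \<gamma>' y"] by simp
    then show ?thesis using that by simp
  qed
  show "?f (x \<otimes>\<^bsub>H\<^esub> y) = ?f x \<otimes>\<^bsub>H\<^esub> ?f y" if "x \<in> carrier H" "y \<in> carrier H" for x y
    using that L_mult[OF \<gamma> \<gamma>_L that] by (simp add: R'_mult)
  show "\<Delta> (?f h) = tensor_map K H H ?f ?f (\<Delta> h)" if h: "h \<in> carrier H" for h
  proof -
    note HHm = HH.tensor_module
    note pure = bilinear_compose[OF HH.bilinear_pure]
    have "tensor_map K H H ?f ?f (\<Delta> h)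
      = tensor_lift HH (\<lambda>a b. pure_tensor K H H (R \<gamma>' (L \<gamma> a)) (L \<gamma> (R \<gamma>' b))) (\<Delta> h)"
      unfolding tensor_map_def
      by (intro HH.lift_cong comult_closed h) (simp add: L_R[OF \<gamma> \<gamma>'])
    also have "\<dots> = tensor_lift HH (\<lambda>a b. pure_tensor K H H (R \<gamma>' a) (L \<gamma> (R \<gamma>' (R \<gamma> b)))) (\<Delta> h)"
      by (rule lift_L_R_middle[OF \<gamma> HHm pure[OF hom(4) module_hom_compose[OF hom(1,4)]] h])
    also have "\<dots> = tensor_lift HH (\<lambda>a b. pure_tensor K H H (R \<gamma>' a) (L \<gamma> b)) (\<Delta> h)"
      by (intro HH.lift_cong comult_closed h) simp
    also have "\<dots> = tensor_lift HH (\<lambda>a b. pure_tensor K H H (R \<gamma>' a) b) (\<Delta> (L \<gamma> h))"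
      by (rule lift_comult_L[symmetric, OF \<gamma> HHm pure[OF hom(4) module_hom_ident] h])
    also have "\<dots> = \<Delta> (?f h)"
      using comult_R[OF \<gamma>', of "L \<gamma> h"] h by (simp add: tensor_map_def)
    finally show ?thesis ..
  qed
qed

section \<open>The comultiplication of the dual\<close>

lemma dual_module: "module K D"
  by (rule dual_algebra_module[OF H_module])

lemma evaluation_hom: "h \<in> carrier H \<Longrightarrow> (\<lambda>\<phi>. \<phi> h) \<in> module_hom K D (self_module K)"
  by (intro module_homI) (auto simp: dual_algebra_linear_simps functional_closed[OF functionalI])

lemma dual_multiplicative: "two_multiplicative_modules K D D"
proof -
  interpret D: module K D by (rule dual_module)
  note f = functionalI
  have left: "(\<phi> \<oplus>\<^bsub>D\<^esub> \<psi>) \<otimes>\<^bsub>D\<^esub> \<chi> = \<phi> \<otimes>\<^bsub>D\<^esub> \<chi> \<oplus>\<^bsub>D\<^esub> \<psi> \<otimes>\<^bsub>D\<^esub> \<chi>"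
    and right: "\<chi> \<otimes>\<^bsub>D\<^esub> (\<phi> \<oplus>\<^bsub>D\<^esub> \<psi>) = \<chi> \<otimes>\<^bsub>D\<^esub> \<phi> \<oplus>\<^bsub>D\<^esub> \<chi> \<otimes>\<^bsub>D\<^esub> \<psi>"
    if D: "\<phi> \<in> carrier D" "\<psi> \<in> carrier D" "\<chi> \<in> carrier D" for \<phi> \<psi> \<chi>
  proof -
    note closed = D f[OF D(1)] f[OF D(2)] f[OF D(3)] f[OF D.a_closed[OF D(1,2)]]
    note * = dual_mult_closed D.a_closed closed
    show "(\<phi> \<oplus>\<^bsub>D\<^esub> \<psi>) \<otimes>\<^bsub>D\<^esub> \<chi> = \<phi> \<otimes>\<^bsub>D\<^esub> \<chi> \<oplus>\<^bsub>D\<^esub> \<psi> \<otimes>\<^bsub>D\<^esub> \<chi>"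
      using dual_mult_L[OF closed(7,6)] dual_mult_L[OF closed(4,6)] dual_mult_L[OF closed(5,6)]
      by (intro dual_eqI *) (simp, simp add: dual_algebra_linear_simps L_closed closed)
    show "\<chi> \<otimes>\<^bsub>D\<^esub> (\<phi> \<oplus>\<^bsub>D\<^esub> \<psi>) = \<chi> \<otimes>\<^bsub>D\<^esub> \<phi> \<oplus>\<^bsub>D\<^esub> \<chi> \<otimes>\<^bsub>D\<^esub> \<psi>"
      using dual_mult_R[OF closed(6,7)] dual_mult_R[OF closed(6,4)] dual_mult_R[OF closed(6,5)]
      by (intro dual_eqI *) (simp, simp add: dual_algebra_linear_simps R_closed closed)
  qed
  have left': "(c \<odot>\<^bsub>D\<^esub> \<phi>) \<otimes>\<^bsub>D\<^esub> \<chi> = c \<odot>\<^bsub>D\<^esub> (\<phi> \<otimes>\<^bsub>D\<^esub> \<chi>)"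
    and right': "\<chi> \<otimes>\<^bsub>D\<^esub> (c \<odot>\<^bsub>D\<^esub> \<phi>) = c \<odot>\<^bsub>D\<^esub> (\<chi> \<otimes>\<^bsub>D\<^esub> \<phi>)"
    if c: "c \<in> carrier K" and D: "\<phi> \<in> carrier D" "\<chi> \<in> carrier D" for c \<phi> \<chi>
  proof -
    note closed = D f[OF D(1)] f[OF D(2)] f[OF D.smult_closed[OF c D(1)]]
    note * = dual_mult_closed D.smult_closed closed c
    show "(c \<odot>\<^bsub>D\<^esub> \<phi>) \<otimes>\<^bsub>D\<^esub> \<chi> = c \<odot>\<^bsub>D\<^esub> (\<phi> \<otimes>\<^bsub>D\<^esub> \<chi>)"
      using dual_mult_L[OF closed(5,4)] dual_mult_L[OF closed(3,4)]
      by (intro dual_eqI *) (simp, simp add: dual_algebra_linear_simps L_closed closed)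
    show "\<chi> \<otimes>\<^bsub>D\<^esub> (c \<odot>\<^bsub>D\<^esub> \<phi>) = c \<odot>\<^bsub>D\<^esub> (\<chi> \<otimes>\<^bsub>D\<^esub> \<phi>)"
      using dual_mult_R[OF closed(4,5)] dual_mult_R[OF closed(4,3)]
      by (intro dual_eqI *) (simp, simp add: dual_algebra_linear_simps R_closed closed)
  qed
  have "bilinear K D D D (mult D)"
    by (intro bilinearI module_homI left right left' right' dual_mult_closed f)
  then show ?thesis
    by (intro two_multiplicative_modules.intro two_modules.intro two_multiplicative_modules_axioms.intro
        dual_module)
qed

sublocale DD: two_multiplicative_modules K D D
  by (rule dual_multiplicative)

abbreviation "DD \<equiv> tensor K D D"

text \<open>
  The pairing of \<open>H\<^sup>* \<otimes> H\<^sup>*\<close> with \<open>h \<otimes> g\<close>. The comultiplication of the dual is characterised by it.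
\<close>

definition eval2 :: "'h \<Rightarrow> 'h \<Rightarrow> (('h \<Rightarrow> 'k) \<times> ('h \<Rightarrow> 'k)) list set \<Rightarrow> 'k"
  where "eval2 h g T = tensor_lift K (\<lambda>\<alpha> \<beta>. \<alpha> h \<otimes>\<^bsub>K\<^esub> \<beta> g) T"

lemma eval2_bilinear:
  assumes "h \<in> carrier H" "g \<in> carrier H"
  shows "bilinear K D D (self_module K) (\<lambda>\<alpha> \<beta>. \<alpha> h \<otimes>\<^bsub>K\<^esub> \<beta> g)"
  using bilinear_compose[OF bilinear_smult[OF module_K] evaluation_hom[OF assms(1)]
      evaluation_hom[OF assms(2)]] by simp

lemma eval2_hom:
  "h \<in> carrier H \<Longrightarrow> g \<in> carrier H \<Longrightarrow> eval2 h g \<in> module_hom K DD (self_module K)"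
  unfolding eval2_def[abs_def] using DD.lift_hom[OF module_K eval2_bilinear] by simp

lemma eval2_pure:
  assumes "h \<in> carrier H" "g \<in> carrier H" "\<alpha> \<in> carrier D" "\<beta> \<in> carrier D"
  shows "eval2 h g (pure_tensor K D D \<alpha> \<beta>) = \<alpha> h \<otimes>\<^bsub>K\<^esub> \<beta> g"
  unfolding eval2_def using DD.lift_pure[OF module_K eval2_bilinear assms(3,4)] assms by simp

text \<open>
  By the formulas for convolution products, multiplying by \<open>\<gamma> \<otimes> \<gamma>\<close> is adjoint to applying an arrow of
  \<open>\<gamma>\<close> to both arguments of the pairing.
\<close>

lemma
  assumes h: "h \<in> carrier H" and g: "g \<in> carrier H" and \<gamma>: "\<gamma> \<in> carrier D" and T: "T \<in> carrier DD"
  shows eval2_pure_mult: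
      "eval2 h g (pure_tensor K D D \<gamma> \<gamma> \<otimes>\<^bsub>DD\<^esub> T) = eval2 (R \<gamma> h) (R \<gamma> g) T"
    and eval2_mult_pure:
      "eval2 h g (T \<otimes>\<^bsub>DD\<^esub> pure_tensor K D D \<gamma> \<gamma>) = eval2 (L \<gamma> h) (L \<gamma> g) T"
proof -
  note ev = DD.tensor_module module_K eval2_hom[OF h g]
  note closed = dual_mult_closed functionalI \<gamma> h g L_closed R_closed
  have "eval2 h g (pure_tensor K D D \<gamma> \<gamma> \<otimes>\<^bsub>DD\<^esub> T)
    = tensor_lift K (\<lambda>\<alpha> \<beta>. eval2 h g (pure_tensor K D D (\<gamma> \<otimes>\<^bsub>D\<^esub> \<alpha>) (\<gamma> \<otimes>\<^bsub>D\<^esub> \<beta>))) T"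
    using DD.hom_lift[OF ev DD.bilinear_times[OF DD.bilinear_pure \<gamma> \<gamma>] T] DD.pure_mult[OF \<gamma> \<gamma> T]
    by simp
  also have "\<dots> = tensor_lift K (\<lambda>\<alpha> \<beta>. \<alpha> (R \<gamma> h) \<otimes>\<^bsub>K\<^esub> \<beta> (R \<gamma> g)) T"
    by (rule DD.lift_cong[OF T]) (simp add: eval2_pure closed dual_mult_R)
  finally show "eval2 h g (pure_tensor K D D \<gamma> \<gamma> \<otimes>\<^bsub>DD\<^esub> T) = eval2 (R \<gamma> h) (R \<gamma> g) T"
    by (simp add: eval2_def)
  note r = bilinear_left[OF DD.bilinear_mult_left \<gamma>]
  have "eval2 h g (T \<otimes>\<^bsub>DD\<^esub> pure_tensor K D D \<gamma> \<gamma>)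
    = tensor_lift K (\<lambda>\<alpha> \<beta>. eval2 h g (pure_tensor K D D (\<alpha> \<otimes>\<^bsub>D\<^esub> \<gamma>) (\<beta> \<otimes>\<^bsub>D\<^esub> \<gamma>))) T"
    using DD.hom_lift[OF ev bilinear_compose[OF DD.bilinear_pure r r] T] DD.mult_pure[OF \<gamma> \<gamma> T]
    by simp
  also have "\<dots> = tensor_lift K (\<lambda>\<alpha> \<beta>. \<alpha> (L \<gamma> h) \<otimes>\<^bsub>K\<^esub> \<beta> (L \<gamma> g)) T"
    by (rule DD.lift_cong[OF T]) (simp add: eval2_pure closed dual_mult_L)
  finally show "eval2 h g (T \<otimes>\<^bsub>DD\<^esub> pure_tensor K D D \<gamma> \<gamma>) = eval2 (L \<gamma> h) (L \<gamma> g) T"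
    by (simp add: eval2_def)
qed

lemma dual_basis:
  assumes "VS.fin_dim"
  obtains bs where "bs \<in> lists (carrier H \<times> carrier D)"
    "\<And>h. h \<in> carrier H \<Longrightarrow> h = pair_sum H (\<lambda>e \<phi>. \<phi> h \<odot>\<^bsub>H\<^esub> e) bs"
proof -
  obtain bs where bs: "bs \<in> lists (carrier H \<times> module_hom K H (self_module K))"
    "\<And>h. h \<in> carrier H \<Longrightarrow> h = pair_sum H (\<lambda>e \<phi>. \<phi> h \<odot>\<^bsub>H\<^esub> e) bs"
    using VS.finite_dual_basis[OF assms] by blast
  define r where "r \<phi> = restrict \<phi> (carrier H)" for \<phi> :: "'h \<Rightarrow> 'k"
  let ?bs = "map (\<lambda>(e, \<phi>). (e, r \<phi>)) bs"
  have "?bs \<in> lists (carrier H \<times> carrier D)"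
    using bs(1) restrict_in_dual_algebra[OF H_module] by (induction bs) (auto simp: r_def[symmetric])
  moreover have "h = pair_sum H (\<lambda>e \<phi>. \<phi> h \<odot>\<^bsub>H\<^esub> e) ?bs" if "h \<in> carrier H" for h
    using bs(2)[OF that] that
    by (simp add: pair_sum_map[where f = "\<lambda>e \<phi>. e" and g = "\<lambda>e. r"], simp add: r_def)
  ultimately show ?thesis using that by blast
qed

lemma functional_expand:
  assumes bs: "bs \<in> lists (carrier H \<times> carrier D)"
    "\<And>h. h \<in> carrier H \<Longrightarrow> h = pair_sum H (\<lambda>e \<phi>. \<phi> h \<odot>\<^bsub>H\<^esub> e) bs"
    and \<alpha>: "functional \<alpha>" and h: "h \<in> carrier H"
  shows "\<alpha> h = pair_sum K (\<lambda>e \<phi>. \<phi> h \<otimes>\<^bsub>K\<^esub> \<alpha> e) bs"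
proof -
  have "\<alpha> h = pair_sum K (\<lambda>e \<phi>. \<alpha> (\<phi> h \<odot>\<^bsub>H\<^esub> e)) bs"
    using module_hom_pair_sum[OF H_module module_K \<alpha> bs(1), of "\<lambda>e \<phi>. \<phi> h \<odot>\<^bsub>H\<^esub> e"] bs(2)[OF h] h
    by (simp add: functional_closed[OF functionalI])
  also have "\<dots> = pair_sum K (\<lambda>e \<phi>. \<phi> h \<otimes>\<^bsub>K\<^esub> \<alpha> e) bs"
    using h by (intro pair_sum_cong[OF bs(1)])
      (simp add: functional_smult[OF \<alpha>] functional_closed[OF functionalI])
  finally show ?thesis .
qed

text \<open>
  Contracting \<open>T\<close> with a basis vector \<open>e\<close> in the first factor gives a functional that the values of the
  pairing determine, and \<open>T\<close> is the sum of \<open>e\<^sup>* \<otimes> (T contracted with e)\<close> over a dual basis. The latter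
  is a linear identity in \<open>T\<close>, so it need only be checked on pure tensors.
\<close>

lemma eval2_inject:
  assumes fin: "VS.fin_dim" and T: "T \<in> carrier DD" and U: "U \<in> carrier DD"
    and eq: "\<And>h g. h \<in> carrier H \<Longrightarrow> g \<in> carrier H \<Longrightarrow> eval2 h g T = eval2 h g U"
  shows "T = U"
proof -
  obtain bs where bs: "bs \<in> lists (carrier H \<times> carrier D)"
    "\<And>h. h \<in> carrier H \<Longrightarrow> h = pair_sum H (\<lambda>e \<phi>. \<phi> h \<odot>\<^bsub>H\<^esub> e) bs"
    using dual_basis[OF fin] by blast
  define contract where "contract e X = tensor_lift D (\<lambda>\<alpha> \<beta>. \<alpha> e \<odot>\<^bsub>D\<^esub> \<beta>) X" for e :: 'h and X
  have bil: "bilinear K D D D (\<lambda>\<alpha> \<beta>. \<alpha> e \<odot>\<^bsub>D\<^esub> \<beta>)" if "e \<in> carrier H" for e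
    by (rule bilinear_compose[OF bilinear_smult[OF dual_module] evaluation_hom[OF that] module_hom_ident])
  have hom: "contract e \<in> module_hom K DD D" if "e \<in> carrier H" for e
    unfolding contract_def[abs_def] by (rule DD.lift_hom[OF dual_module bil[OF that]])
  have contract: "contract e X g = eval2 e g X"
    if "e \<in> carrier H" "g \<in> carrier H" "X \<in> carrier DD" for e g X
  proof -
    have "contract e X g = tensor_lift K (\<lambda>\<alpha> \<beta>. (\<alpha> e \<odot>\<^bsub>D\<^esub> \<beta>) g) X"
      unfolding contract_def
      using DD.hom_lift[OF dual_module module_K evaluation_hom[OF that(2)] bil[OF that(1)] that(3)]
      by simp
    then show ?thesis using that(2) by (simp add: eval2_def dual_algebra_linear_simps)
  qed
  define G where "G X = pair_sum DD (\<lambda>e \<phi>. pure_tensor K D D \<phi> (contract e X)) bs" for X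
  have G: "G \<in> module_hom K DD DD"
    unfolding G_def[abs_def]
    by (rule pair_sum_in_module_hom[OF DD.tensor_module bs(1)])
      (rule module_hom_compose[OF bilinear_right[OF DD.bilinear_pure] hom])
  have id: "G X = X" if X: "X \<in> carrier DD" for X
  proof (rule DD.tensor_hom_eqI[OF DD.tensor_module G module_hom_ident X])
    fix \<alpha> \<beta> assume \<alpha>: "\<alpha> \<in> carrier D" and \<beta>: "\<beta> \<in> carrier D"
    have \<alpha>K: "\<alpha> e \<in> carrier K" if "e \<in> carrier H" for e
      using functional_closed[OF functionalI[OF \<alpha>] that] .
    have sum: "pair_sum D (\<lambda>e \<phi>. \<alpha> e \<odot>\<^bsub>D\<^esub> \<phi>) bs = \<alpha>"
    proof (rule dual_eqI)
      show c: "pair_sum D (\<lambda>e \<phi>. \<alpha> e \<odot>\<^bsub>D\<^esub> \<phi>) bs \<in> carrier D"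
        using \<alpha>K by (intro pair_sum_closed[OF module.axioms(2)[OF dual_module] bs(1)]) simp
      fix h assume h: "h \<in> carrier H"
      have "pair_sum D (\<lambda>e \<phi>. \<alpha> e \<odot>\<^bsub>D\<^esub> \<phi>) bs h = pair_sum K (\<lambda>e \<phi>. (\<alpha> e \<odot>\<^bsub>D\<^esub> \<phi>) h) bs"
        using module_hom_pair_sum[OF dual_module module_K evaluation_hom[OF h] bs(1),
            of "\<lambda>e \<phi>. \<alpha> e \<odot>\<^bsub>D\<^esub> \<phi>"] \<alpha>K
        by simp
      also have "\<dots> = pair_sum K (\<lambda>e \<phi>. \<phi> h \<otimes>\<^bsub>K\<^esub> \<alpha> e) bs"
        using h by (intro pair_sum_cong[OF bs(1)])
          (simp add: dual_algebra_linear_simps \<alpha>K K_commute functional_closed[OF functionalI])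
      also have "\<dots> = \<alpha> h" by (rule functional_expand[symmetric, OF bs functionalI[OF \<alpha>] h])
      finally show "pair_sum D (\<lambda>e \<phi>. \<alpha> e \<odot>\<^bsub>D\<^esub> \<phi>) bs h = \<alpha> h" .
    qed (rule \<alpha>)
    have "G (pure_tensor K D D \<alpha> \<beta>) = pair_sum DD (\<lambda>e \<phi>. pure_tensor K D D (\<alpha> e \<odot>\<^bsub>D\<^esub> \<phi>) \<beta>) bs"
      unfolding G_def
      by (rule pair_sum_cong[OF bs(1)])
        (simp add: contract_def DD.lift_pure[OF dual_module bil \<alpha> \<beta>] \<alpha>K \<beta>
          DD.pure_smult_left DD.pure_smult_right)
    also have "\<dots> = pure_tensor K D D (pair_sum D (\<lambda>e \<phi>. \<alpha> e \<odot>\<^bsub>D\<^esub> \<phi>) bs) \<beta>"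
      using \<alpha>K by (intro module_hom_pair_sum[symmetric, OF dual_module DD.tensor_module
            bilinear_left[OF DD.bilinear_pure \<beta>] bs(1)]) simp
    finally show "G (pure_tensor K D D \<alpha> \<beta>) = pure_tensor K D D \<alpha> \<beta>" by (simp add: sum)
  qed
  have "G T = G U"
    unfolding G_def
  proof (rule pair_sum_cong[OF bs(1)])
    fix e \<phi> assume e: "e \<in> carrier H"
    have "contract e T = contract e U"
      by (intro dual_eqI module_hom_in[OF hom[OF e]] T U) (simp add: contract e T U eq)
    then show "pure_tensor K D D \<phi> (contract e T) = pure_tensor K D D \<phi> (contract e U)" by simp
  qed
  then show ?thesis by (simp add: id T U)
qed

text \<open>
  Expanding \<open>h\<close> in a basis gives \<open>\<phi>(hg)\<close> as the sum of \<open>e\<^sup>*(h) \<phi>(eg)\<close>, which is the value of the sum of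
  the tensors \<open>e\<^sup>* \<otimes> \<phi>(e _)\<close>.
\<close>

lemma eval2_surj:
  assumes fin: "VS.fin_dim" and \<phi>: "functional \<phi>"
  shows "\<exists>T\<in>carrier DD. \<forall>h\<in>carrier H. \<forall>g\<in>carrier H. eval2 h g T = \<phi> (h \<otimes>\<^bsub>H\<^esub> g)"
proof -
  obtain bs where bs: "bs \<in> lists (carrier H \<times> carrier D)"
    "\<And>h. h \<in> carrier H \<Longrightarrow> h = pair_sum H (\<lambda>e \<phi>. \<phi> h \<odot>\<^bsub>H\<^esub> e) bs"
    using dual_basis[OF fin] by blast
  interpret DDm: module K DD by (rule DD.tensor_module)
  define c where "c e = restrict (\<lambda>g. \<phi> (e \<otimes>\<^bsub>H\<^esub> g)) (carrier H)" for e
  have c: "c e \<in> carrier D" if "e \<in> carrier H" for e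
    unfolding c_def
    by (intro restrict_in_dual_algebra[OF H_module] module_hom_compose[OF \<phi> bilinear_right[OF bilinear_mult that]])
  define T where "T = pair_sum DD (\<lambda>e \<psi>. pure_tensor K D D \<psi> (c e)) bs"
  have "eval2 h g T = \<phi> (h \<otimes>\<^bsub>H\<^esub> g)" if h: "h \<in> carrier H" and g: "g \<in> carrier H" for h g
  proof -
    have "eval2 h g T = pair_sum K (\<lambda>e \<psi>. eval2 h g (pure_tensor K D D \<psi> (c e))) bs"
      unfolding T_def
      using module_hom_pair_sum[OF DD.tensor_module module_K eval2_hom[OF h g] bs(1),
          of "\<lambda>e \<psi>. pure_tensor K D D \<psi> (c e)"] c
      by (simp add: DD.pure_closed)
    also have "\<dots> = pair_sum K (\<lambda>e \<psi>. \<psi> h \<otimes>\<^bsub>K\<^esub> \<phi> (e \<otimes>\<^bsub>H\<^esub> g)) bs"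
      using g by (intro pair_sum_cong[OF bs(1)]) (simp add: eval2_pure h c, simp add: c_def)
    also have "\<dots> = \<phi> (h \<otimes>\<^bsub>H\<^esub> g)"
      by (rule functional_expand[symmetric, OF bs
            module_hom_compose[OF \<phi> bilinear_left[OF bilinear_mult g]] h])
    finally show ?thesis .
  qed
  moreover have "T \<in> carrier DD"
    unfolding T_def by (intro pair_sum_closed[OF DDm.abelian_group_axioms bs(1)] DD.pure_closed c)
  ultimately show ?thesis by blast
qed

lemma dual_fields [simp]:
  "carrier (dual K H) = carrier D" "mult (dual K H) = mult D" "one (dual K H) = one D"
  "zero (dual K H) = zero D" "add (dual K H) = add D" "smult (dual K H) = smult D"
  by (simp_all add: dual_def module.extend_def)

lemma dual_comult:
  assumes fin: "VS.fin_dim" and \<phi>: "functional \<phi>"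
  shows "comult (dual K H) \<phi> \<in> carrier DD"
    and "h \<in> carrier H \<Longrightarrow> g \<in> carrier H \<Longrightarrow> eval2 h g (comult (dual K H) \<phi>) = \<phi> (h \<otimes>\<^bsub>H\<^esub> g)"
proof -
  let ?P = "\<lambda>T. T \<in> carrier DD \<and> (\<forall>h\<in>carrier H. \<forall>g\<in>carrier H. eval2 h g T = \<phi> (h \<otimes>\<^bsub>H\<^esub> g))"
  have "comult (dual K H) \<phi> = (THE T. ?P T)"
    by (simp add: dual_def module.extend_def weak_hopf.fields_def eval2_def)
  moreover have "\<exists>!T. ?P T"
  proof (rule ex_ex1I)
    show "\<exists>T. ?P T" using eval2_surj[OF assms] by blast
    show "T = U" if "?P T" "?P U" for T U using that by (intro eval2_inject[OF fin]) simp_all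
  qed
  ultimately have "?P (comult (dual K H) \<phi>)" using theI'[of ?P] by simp
  then show "comult (dual K H) \<phi> \<in> carrier DD"
    "h \<in> carrier H \<Longrightarrow> g \<in> carrier H \<Longrightarrow> eval2 h g (comult (dual K H) \<phi>) = \<phi> (h \<otimes>\<^bsub>H\<^esub> g)"
    by auto
qed

text \<open>
  Evaluating the two equations for \<open>\<Delta>(\<gamma>)\<close> at \<open>h \<otimes> g\<close> turns them into
  \<open>\<gamma>(hg) = \<epsilon>(R \<gamma> h \<cdot> R \<gamma> g)\<close> and \<open>\<gamma>(hg) = \<epsilon>(L \<gamma> h \<cdot> L \<gamma> g)\<close>. The unit of the dual is \<open>\<epsilon>\<close>, so
  \<open>\<Delta>(1)\<close> of the dual evaluates to \<open>\<epsilon>(hg)\<close>.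
\<close>

lemma group_like_dual_conjugation:
  assumes fin: "VS.fin_dim" and "group_like K (dual K H) \<gamma>"
  shows "(\<lambda>h. R (inv\<^bsub>dual K H\<^esub> \<gamma>) (L \<gamma> h)) \<in> weak_hopf_auto K H"
proof -
  interpret D: Group.monoid D by (rule dual_monoid)
  have inv_eq: "inv\<^bsub>dual K H\<^esub> \<gamma> = inv\<^bsub>D\<^esub> \<gamma>" by (simp add: m_inv_def)
  have eqs: "tensor K (dual K H) (dual K H) = DD"
    "pure_tensor K (dual K H) (dual K H) = pure_tensor K D D"
    by (rule tensor_cong; simp)+
  have left: "comult (dual K H) \<gamma> = pure_tensor K D D \<gamma> \<gamma> \<otimes>\<^bsub>DD\<^esub> comult (dual K H) \<one>\<^bsub>D\<^esub>"
    and right: "comult (dual K H) \<gamma> = comult (dual K H) \<one>\<^bsub>D\<^esub> \<otimes>\<^bsub>DD\<^esub> pure_tensor K D D \<gamma> \<gamma>"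
    and "\<gamma> \<in> Units (dual K H)"
    using assms(2)[unfolded group_like_def eqs dual_fields] by blast+
  then have unit: "\<gamma> \<in> Units D" by (simp add: Units_def)
  have \<gamma>: "\<gamma> \<in> carrier D" "inv\<^bsub>D\<^esub> \<gamma> \<in> carrier D" using unit by auto
  note f = functionalI[OF \<gamma>(1)] functionalI[OF dual_one_closed]
  have one: "eval2 h g (comult (dual K H) \<one>\<^bsub>D\<^esub>) = \<epsilon> (h \<otimes>\<^bsub>H\<^esub> g)"
    if "h \<in> carrier H" "g \<in> carrier H" for h g
    using dual_comult(2)[OF fin f(2) that] that by (simp add: dual_one)
  have "\<gamma> (h \<otimes>\<^bsub>H\<^esub> g) = \<epsilon> (L \<gamma> h \<otimes>\<^bsub>H\<^esub> L \<gamma> g)" "\<gamma> (h \<otimes>\<^bsub>H\<^esub> g) = \<epsilon> (R \<gamma> h \<otimes>\<^bsub>H\<^esub> R \<gamma> g)"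
    if "h \<in> carrier H" "g \<in> carrier H" for h g
    using dual_comult(2)[OF fin f(1) that] that
      eval2_mult_pure[OF that \<gamma>(1) dual_comult(1)[OF fin f(2)]]
      eval2_pure_mult[OF that \<gamma>(1) dual_comult(1)[OF fin f(2)]]
    by (simp_all add: right[symmetric] left[symmetric] one L_closed R_closed f(1))
  then show ?thesis
    unfolding inv_eq using unit by (intro dual_conjugation functionalI \<gamma>) simp_all
qed

end

theorem proposition4p7:
  fixes K :: "('k, 'r) ring_scheme" and H :: "('k, 'h, 'm) weak_hopf_scheme"
  assumes "weak_hopf_algebra K H"
  shows "(\<forall>g. group_like K H g \<longrightarrow>
           (\<lambda>h. g \<otimes>\<^bsub>H\<^esub> h \<otimes>\<^bsub>H\<^esub> inv\<^bsub>H\<^esub> g) \<in> weak_hopf_auto K H)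
       \<and> (vectorspace.fin_dim K H \<longrightarrow>
           (\<forall>\<gamma>. group_like K (dual K H) \<gamma> \<longrightarrow>
             (\<lambda>h. arrow_right H (arrow_left H \<gamma> h) (inv\<^bsub>dual K H\<^esub> \<gamma>)) \<in> weak_hopf_auto K H))"
proof -
  interpret weak_hopf_algebra K H by fact
  show ?thesis
    by (intro conjI allI impI group_like_conjugation group_like_dual_conjugation)
qed

end
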